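(* Let $P(X)\in\mathbb Z[X]$ of degree $d$, with roots $\alpha_1,\dots,\alpha_d$ and constant term $a_0$, satisfy the standing assumptions in the context. Assume that $P(X)$ is monic and expansive, and let $f=P$ (the case $k=0$). Moreover, suppose that $$\text{either }\ \rho^f_0\ge2\rho^f_{-1}\ge2^2\rho^f_{-2}\ge\cdots>0\quad\text{or}\quad \rho^f_0\le2\rho^f_{-1}\le2^2\rho^f_{-2}\le\cdots<0$$ (where the chains of inequalities mean that all terms are positive, respectively negative), which is equivalent to: either $$H_d^{(0)}(\alpha_1^{-1},\dots,\alpha_d^{-1})\ge2H_d^{(1)}(\alpha_1^{-1},\dots,\alpha_d^{-1})\ge2^2H_d^{(2)}(\alpha_1^{-1},\dots,\alpha_d^{-1})\ge\cdots>0$$ or $$H_d^{(0)}(\alpha_1^{-1},\dots,\alpha_d^{-1})\le2H_d^{(1)}(\alpha_1^{-1},\dots,\alpha_d^{-1})\le2^2H_d^{(2)}(\alpha_1^{-1},\dots,\alpha_d^{-1})\le\cdots<0 .$$ Then $|a_0|^{-1}E_d(\alpha_1^{-1},\dots,\alpha_d^{-1})$ is the minimal limit point of $\mathcal L(P(X))$. Moreover, $$\mathcal L(P(X))\cap\Bigl(0,\tfrac1{|a_0|}E_d(\alpha_1^{-1},\dots,\alpha_d^{-1})\Bigr)=\Bigl\{\tfrac1{|a_0|}E_d^{(k)}(\alpha_1^{-1},\dots,\alpha_d^{-1}) : k=0,1,\dots\Bigr\}.$$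
   Context: Setting. $P(X)=a_dX^d+\cdots+a_0\in\mathbb Z[X]$ with $d\ge1$, $a_d\ge1$, such that (i) $\gcd(a_d,\dots,a_0)=1$ and $a_0\ne0$; (ii) $P$ has no multiple roots; (iii) every irreducible factor of $P$ in $\mathbb Z[X]$ has at least one root of modulus greater than $1$. The roots of $P$ are $\alpha_1,\dots,\alpha_d$, ordered so that $|\alpha_i|>1$ for $1\le i\le p$ and $|\alpha_i|\le1$ for $p+1\le i\le d$, where $p=r_1+2r_2$, $\alpha_i\in\mathbb R$ for $1\le i\le r_1$, and $\alpha_{r_1+i}\in\mathbb C\setminus\mathbb R$, $\alpha_{r_1+r_2+i}=\overline{\alpha_{r_1+i}}$ for $1\le i\le r_2$. $P$ is called expansive (or expanding) if $p=d$. $\Xi_0$ is the set of $\mathbf g=(g_1,\dots,g_p)\in\mathbb R^{r_1}\times\mathbb C^{2r_2}$ with $\overline{g_{r_1+i}}=g_{r_1+r_2+i}$ for $1\le i\le r_2$; for $\mathbf g\in\Xi_0$, $x_n(\mathbf g)=\sum_{i=1}^p g_i\alpha_i^n\in\mathbb R$. With $\|x\|$ the distance from $x$ to the nearest integer, $\mathcal L(P)=\{\limsup_{n\to\infty}\|x_n(\mathbf g)\| : \mathbf g\in\Xi_0\}$. A limit point is an accumulation point. For $f=P$ and $n\in\mathbb Z$, $\rho^f_n=\frac{-1}{2\pi i}\int_{|z|=r}\frac{z^{n-1}}{f(z)}\,dz$, the circle being positively oriented with $1<r<\min_{1\le i\le p}|\alpha_i|$. Complete homogeneous symmetric polynomials: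 $H_r^{(m)}(X_1,\dots,X_r)=\sum_{i_1,\dots,i_r\ge0,\ i_1+\cdots+i_r=m}X_1^{i_1}\cdots X_r^{i_r}$ for $m\ge0$, $r\ge1$. Define $$E(X)=\frac{1-(1-X)\prod_{m=0}^\infty(1-X^{2^m})}{2X},\qquad E^{(k)}(X)=\frac{1+X^{2^k}-(1-X)\prod_{m=0}^{k-1}(1-X^{2^m})}{2X(1+X^{2^k})}\quad(k\ge0),$$ with $\prod_{m=0}^{k-1}(1-X^{2^m})=1$ for $k=0$, and for $r\ge1$ $$E_r(X_1,\dots,X_r)=\sum_{i=1}^r\Bigl(\prod_{1\le j\le r,\ j\ne i}\frac{X_i}{X_i-X_j}\Bigr)E(X_i),\qquad E_r^{(k)}(X_1,\dots,X_r)=\sum_{i=1}^r\Bigl(\prod_{1\le j\le r,\ j\ne i}\frac{X_i}{X_i-X_j}\Bigr)E^{(k)}(X_i).$$ *)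

theory Defs
  imports
    "HOL-Complex_Analysis.Complex_Analysis"
    "HOL-Computational_Algebra.Computational_Algebra"
    "HOL-Library.FuncSet"
    "HOL-Library.Complex_Order"
begin

abbreviation complex_poly :: "int poly \<Rightarrow> complex poly" where
  "complex_poly f \<equiv> map_poly of_int f"

definition admissible :: "int poly \<Rightarrow> bool" where
  "admissible P \<longleftrightarrow>
     degree P \<ge> 1 \<and> lead_coeff P \<ge> 1 \<and>
     content P = 1 \<and> coeff P 0 \<noteq> 0 \<and>
     rsquarefree (complex_poly P) \<and>
     (\<forall>Q. irreducible Q \<and> Q dvd P \<longrightarrow>
        (\<exists>z. poly (complex_poly Q) z = 0 \<and> cmod z > 1))"

text \<open>
  The roots are listed with multiplicity as \<open>\<alpha> 1, \<dots>, \<alpha> d\<close>, where \<open>d = degree P\<close>; values of \<open>\<alpha>\<close>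
  outside \<open>{1..d}\<close> are irrelevant. The first \<open>p = r1 + 2 * r2\<close> roots are those outside the
  closed unit disc: first the real ones, then the non-real ones in two conjugate blocks.
\<close>

definition root_enumeration :: "int poly \<Rightarrow> (nat \<Rightarrow> complex) \<Rightarrow> nat \<Rightarrow> nat \<Rightarrow> bool" where
  "root_enumeration P \<alpha> r1 r2 \<longleftrightarrow>
     complex_poly P = smult (of_int (lead_coeff P)) (\<Prod>i=1..degree P. [:- \<alpha> i, 1:]) \<and>
     r1 + 2 * r2 \<le> degree P \<and>
     (\<forall>i\<in>{1..r1 + 2 * r2}. cmod (\<alpha> i) > 1) \<and>
     (\<forall>i\<in>{r1 + 2 * r2 + 1..degree P}. cmod (\<alpha> i) \<le> 1) \<and>
     (\<forall>i\<in>{1..r1}. \<alpha> i \<in> \<real>) \<and>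
     (\<forall>i\<in>{1..r2}. \<alpha> (r1 + i) \<notin> \<real> \<and> \<alpha> (r1 + r2 + i) = cnj (\<alpha> (r1 + i)))"

definition expansive :: "int poly \<Rightarrow> nat \<Rightarrow> nat \<Rightarrow> bool" where
  "expansive P r1 r2 \<longleftrightarrow> r1 + 2 * r2 = degree P"

definition dist_nearest_int :: "real \<Rightarrow> real" where
  "dist_nearest_int x = \<bar>x - of_int (round x)\<bar>"

text \<open>Only the values \<open>g 1, \<dots>, g p\<close> of a vector \<open>g\<close> matter.\<close>

definition Xi0 :: "nat \<Rightarrow> nat \<Rightarrow> (nat \<Rightarrow> complex) set" where
  "Xi0 r1 r2 = {g. (\<forall>i\<in>{1..r1}. g i \<in> \<real>) \<and>
                   (\<forall>i\<in>{1..r2}. cnj (g (r1 + i)) = g (r1 + r2 + i))}"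

text \<open>For \<open>g \<in> Xi0 r1 r2\<close> and \<open>\<alpha>\<close> ordered as above the sum is real, so \<open>Re\<close> only changes its type.\<close>

definition xseq :: "(nat \<Rightarrow> complex) \<Rightarrow> nat \<Rightarrow> nat \<Rightarrow> (nat \<Rightarrow> complex) \<Rightarrow> nat \<Rightarrow> real" where
  "xseq \<alpha> r1 r2 g n = Re (\<Sum>i=1..r1 + 2 * r2. g i * \<alpha> i ^ n)"

definition limsup_spectrum :: "(nat \<Rightarrow> complex) \<Rightarrow> nat \<Rightarrow> nat \<Rightarrow> real set" where
  "limsup_spectrum \<alpha> r1 r2 =
     {l. \<exists>g\<in>Xi0 r1 r2. limsup (\<lambda>n. ereal (dist_nearest_int (xseq \<alpha> r1 r2 g n))) = ereal l}"

definition rho :: "int poly \<Rightarrow> real \<Rightarrow> int \<Rightarrow> complex" where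
  "rho f r n = - 1 / (2 * of_real pi * \<i>) *
     contour_integral (circlepath 0 r) (\<lambda>z. z powi (n - 1) / poly (complex_poly f) z)"

definition complete_hom :: "nat \<Rightarrow> nat \<Rightarrow> (nat \<Rightarrow> complex) \<Rightarrow> complex" where
  "complete_hom r m X =
     (\<Sum>e | e \<in> {1..r} \<rightarrow>\<^sub>E (UNIV :: nat set) \<and> (\<Sum>j=1..r. e j) = m. \<Prod>j=1..r. X j ^ e j)"

definition E_fun :: "complex \<Rightarrow> complex" where
  "E_fun X = (1 - (1 - X) * (\<Prod>m. 1 - X ^ (2 ^ m))) / (2 * X)"

definition E_trunc :: "nat \<Rightarrow> complex \<Rightarrow> complex" where
  "E_trunc k X =
     (1 + X ^ (2 ^ k) - (1 - X) * (\<Prod>m<k. 1 - X ^ (2 ^ m))) / (2 * X * (1 + X ^ (2 ^ k)))"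

definition E_sym :: "nat \<Rightarrow> (nat \<Rightarrow> complex) \<Rightarrow> complex" where
  "E_sym r X = (\<Sum>i=1..r. (\<Prod>j\<in>{1..r} - {i}. X i / (X i - X j)) * E_fun (X i))"

definition E_sym_trunc :: "nat \<Rightarrow> nat \<Rightarrow> (nat \<Rightarrow> complex) \<Rightarrow> complex" where
  "E_sym_trunc r k X = (\<Sum>i=1..r. (\<Prod>j\<in>{1..r} - {i}. X i / (X i - X j)) * E_trunc k (X i))"

text \<open>
  The order on \<^typ>\<open>complex\<close> is that of \<^theory>\<open>HOL-Library.Complex_Order\<close>: a comparison says that
  the imaginary parts agree and the real parts compare. Hence each of the two chains forces
  all terms to be real.
\<close>

definition monotone_chain :: "(nat \<Rightarrow> complex) \<Rightarrow> bool" where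
  "monotone_chain u \<longleftrightarrow>
     (\<forall>m. 2 ^ m * u m \<ge> 2 ^ Suc m * u (Suc m) \<and> 2 ^ m * u m > 0) \<or>
     (\<forall>m. 2 ^ m * u m \<le> 2 ^ Suc m * u (Suc m) \<and> 2 ^ m * u m < 0)"

definition minimal_limit_point :: "real \<Rightarrow> real set \<Rightarrow> bool" where
  "minimal_limit_point v S \<longleftrightarrow> v islimpt S \<and> (\<forall>y. y islimpt S \<longrightarrow> v \<le> y)"

end

theory Submission
  imports Defs
begin

text \<open>
  Write \<open>h\<^sub>m\<close> for the complete homogeneous polynomial of degree \<open>m\<close> in the inverse roots. Then
  \<open>1 / P(z) = (1 / a\<^sub>0) \<Sum> h\<^sub>m z\<^sup>m\<close>, so \<open>\<rho>\<^sub>-\<^sub>m = - h\<^sub>m / a\<^sub>0\<close> and the two forms of the hypothesis differ by a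
  nonzero real factor. Since \<open>h\<^sub>0 = 1\<close>, the hypothesis says that \<open>h\<close> is positive and that
  \<open>2 h\<^sub>m\<^sub>+\<^sub>1 \<le> h\<^sub>m\<close>.

  Split an orbit as \<open>x = u + e\<close> with \<open>u\<^sub>n\<close> the nearest integer. Because \<open>x\<close> satisfies the recurrence with
  characteristic polynomial \<open>P\<close>, applying that recurrence to \<open>u\<close> gives a bounded integer sequence \<open>s\<close>
  with \<open>-a\<^sub>0 e\<^sub>n = \<Sum> h\<^sub>m s\<^sub>n\<^sub>+\<^sub>m\<close> (the reciprocal power series undoes the recurrence, and \<open>P\<close> has no root in
  the closed unit disc). Conversely, as \<open>P\<close> is monic, every bounded integer sequence whose window
  sums are small comes from an orbit. Up to the factor \<open>1 / |a\<^sub>0|\<close>, the spectrum thus consists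
  of upper limits of \<open>|\<Sum> h\<^sub>m s\<^sub>n\<^sub>+\<^sub>m|\<close> for bounded integer sequences \<open>s\<close>, and every such upper limit
  occurs whose window sums stay in \<open>[-1, 1]\<close> (\<open>digits_of_orbit\<close>, \<open>orbit_of_digits\<close>).

  If such an upper limit is below the threshold, then eventually \<open>s\<close> has digits \<open>-1, 0, 1\<close>
  (\<open>eventually_abs_le_1\<close>) and its nonzero digits alternate in sign (\<open>equal_neighbours_large\<close>). Hence
  \<open>s\<^sub>n = (T\<^sub>n - T\<^sub>n\<^sub>+\<^sub>1) / 2\<close> for a sequence \<open>T\<close> of signs, and the modulus of the window sum becomes
  \<open>(1 + F\<^sub>w(T, n)) / 2\<close>, where \<open>F\<^sub>w(T, n) = - T\<^sub>n \<Sum> w\<^sub>m T\<^sub>n\<^sub>+\<^sub>1\<^sub>+\<^sub>m\<close> with \<open>w\<^sub>m = h\<^sub>m - h\<^sub>m\<^sub>+\<^sub>1\<close>. Each weight is at least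
  the sum of all later ones.

  What remains is a question about sign sequences, settled by renormalisation. Let \<open>\<tau>\<^sub>w\<close> be the value of
  \<open>F\<^sub>w\<close> at the start of the Thue--Morse sequence. If \<open>F\<^sub>w(T, n) < \<tau>\<^sub>w\<close> then three short patterns cannot start
  at \<open>n\<close> (\<open>forbidden_patterns\<close>). If this holds for all large \<open>n\<close>, then \<open>T\<close> is eventually constant, or
  alternating, or the image of a sign sequence \<open>T'\<close> under the Thue--Morse substitution
  (\<open>desubstitution\<close>). In the last case \<open>F\<^sub>w(T, 2n) = w\<^sub>0 + F\<^sub>w\<^sub>'(T', n)\<close> for new weights \<open>w'\<close> of the same kind,
  so \<open>T'\<close> stays below \<open>\<tau>\<^sub>w\<^sub>'\<close> by the same margin; as the total weight at least halves at each step, this stops after finitely many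
  steps (\<open>low_discord_dichotomy\<close>). So \<open>T\<close> is eventually constant, in which case the upper limit is \<open>0\<close>,
  or up to sign it is eventually the image of the alternating sequence under \<open>k\<close> substitutions. The
  corresponding values tend to the threshold from below, and summing the series of these sign sequences
  identifies them with the \<open>E\<^sup>(\<^sup>k\<^sup>)\<close> and the threshold with \<open>E\<close>.
\<close>

section \<open>Sign sequences with superdecreasing weights and the Thue--Morse threshold\<close>

text \<open>
  With such weights the weighted sums of two sign sequences compare as the sequences do
  lexicographically, ties allowed. So a finite prefix determines a weighted sum up to its last weight.
\<close>

definition superdecreasing :: "(nat \<Rightarrow> real) \<Rightarrow> bool" where
  "superdecreasing w \<longleftrightarrow> summable w \<and> (\<forall>m. 0 < w m \<and> (\<Sum>j. w (Suc m + j)) \<le> w m)"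

definition sign_seq :: "(nat \<Rightarrow> real) \<Rightarrow> bool" where
  "sign_seq T \<longleftrightarrow> (\<forall>n. T n = 1 \<or> T n = -1)"

text \<open>
  The weighted sum counts the later entries that differ from \<open>T n\<close> positively and those that agree
  with it negatively, which makes it invariant under \<open>T \<mapsto> - T\<close>.
\<close>

definition discord :: "(nat \<Rightarrow> real) \<Rightarrow> (nat \<Rightarrow> real) \<Rightarrow> nat \<Rightarrow> real" where
  "discord w T n = - T n * (\<Sum>m. w m * T (Suc n + m))"

text \<open>
  Under the substitution below, the entries at distances \<open>2 j + 2\<close> and \<open>2 j + 3\<close> from an even position are
  opposite, so their weights \<open>w (2 j + 1)\<close> and \<open>w (2 j + 2)\<close> combine into one.
\<close>

definition renorm :: "(nat \<Rightarrow> real) \<Rightarrow> nat \<Rightarrow> real" where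
  "renorm w j = w (2 * j + 1) - w (2 * j + 2)"

lemma sign_seqD: "sign_seq T \<Longrightarrow> T n = 1 \<or> T n = -1"
  by (simp add: sign_seq_def)

lemma superdecreasing_pos: "superdecreasing w \<Longrightarrow> 0 < w m"
  by (simp add: superdecreasing_def)

lemma superdecreasing_summable: "superdecreasing w \<Longrightarrow> summable w"
  by (simp add: superdecreasing_def)

lemma superdecreasing_tail: "superdecreasing w \<Longrightarrow> (\<Sum>j. w (Suc m + j)) \<le> w m"
  by (simp add: superdecreasing_def)

lemma superdecreasing_tail_summable: "superdecreasing w \<Longrightarrow> summable (\<lambda>j. w (k + j))"
  using summable_ignore_initial_segment[OF superdecreasing_summable, of w k] by (simp add: add.commute)

lemma superdecreasing_decseq: "superdecreasing w \<Longrightarrow> w (Suc m) \<le> w m"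
proof -
  assume w: "superdecreasing w"
  have "w (Suc m) \<le> (\<Sum>j. w (Suc m + j))"
    using sum_le_suminf[OF superdecreasing_tail_summable[OF w], of "{0}" "Suc m"]
      superdecreasing_pos[OF w] by (simp add: less_imp_le)
  with superdecreasing_tail[OF w, of m] show ?thesis by simp
qed

lemma summable_weighted_signs:
  assumes "superdecreasing w" "sign_seq T"
  shows "summable (\<lambda>m. w (k + m) * T (n + m))"
proof (rule summable_comparison_test')
  show "summable (\<lambda>j. w (k + j))" by (rule superdecreasing_tail_summable[OF assms(1)])
  show "norm (w (k + m) * T (n + m)) \<le> w (k + m)" for m
    using sign_seqD[OF assms(2), of "n + m"] superdecreasing_pos[OF assms(1), of "k + m"] by auto
qed

lemma weighted_signs_bound:
  assumes "superdecreasing w" "sign_seq T"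
  shows "\<bar>\<Sum>m. w (k + m) * T (n + m)\<bar> \<le> (\<Sum>m. w (k + m))"
proof -
  have *: "\<bar>w (k + m) * T (n + m)\<bar> = w (k + m)" for m
    using sign_seqD[OF assms(2), of "n + m"] superdecreasing_pos[OF assms(1), of "k + m"] by auto
  have "summable (\<lambda>m. \<bar>w (k + m) * T (n + m)\<bar>)"
    unfolding * by (rule superdecreasing_tail_summable[OF assms(1)])
  from summable_rabs[OF this] show ?thesis unfolding * .
qed

text \<open>
  By superdecrease the entries beyond position \<open>k\<close> contribute at most \<open>w k\<close>. This is how every
  inequality below is decided by finitely many signs.
\<close>

lemma discord_cut:
  assumes w: "superdecreasing w" and T: "sign_seq T"
  shows "\<bar>discord w T n - (\<Sum>m<Suc k. w m * (- T n * T (Suc n + m)))\<bar> \<le> w k"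
proof -
  have s: "summable (\<lambda>m. w m * T (Suc n + m))"
    using summable_weighted_signs[OF w T, of 0 "Suc n"] by simp
  have "discord w T n - (\<Sum>m<Suc k. w m * (- T n * T (Suc n + m)))
      = - T n * (\<Sum>m. w (Suc k + m) * T (Suc n + Suc k + m))"
    unfolding discord_def
    by (subst suminf_split_initial_segment[OF s, of "Suc k"])
       (simp add: algebra_simps sum_distrib_left sum_negf)
  moreover have "\<bar>T n\<bar> = 1" using sign_seqD[OF T, of n] by auto
  ultimately show ?thesis
    using weighted_signs_bound[OF w T, of "Suc k" "Suc n + Suc k"] superdecreasing_tail[OF w, of k]
    by (simp add: abs_mult)
qed

lemma discord_bound:
  assumes w: "superdecreasing w" and T: "sign_seq T"
  shows "\<bar>discord w T n\<bar> \<le> suminf w"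
proof -
  have "\<bar>T n\<bar> = 1" using sign_seqD[OF T, of n] by auto
  then show ?thesis
    using weighted_signs_bound[OF w T, of 0 "Suc n"] by (simp add: discord_def abs_mult)
qed

text \<open>
  A change of sign right after \<open>n\<close> contributes \<open>w 0\<close>, which later entries can at most cancel.
\<close>

lemma discord_nonneg:
  assumes w: "superdecreasing w" and T: "sign_seq T" and "T n \<noteq> T (Suc n)"
  shows "0 \<le> discord w T n"
  using discord_cut[OF w T, of n 0] sign_seqD[OF T, of n] sign_seqD[OF T, of "Suc n"] assms(3)
  by auto

lemma renorm_pos: "superdecreasing w \<Longrightarrow> 0 < renorm w j"
proof -
  assume w: "superdecreasing w"
  have "(\<Sum>i\<in>{0,1}. w (2*j+2 + i)) \<le> (\<Sum>i. w (2*j+2 + i))"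
    by (rule sum_le_suminf[OF superdecreasing_tail_summable[OF w]])
       (auto simp: superdecreasing_pos[OF w] less_imp_le)
  then have "w (2*j+2) + w (2*j+3) \<le> w (2*j+1)"
    using superdecreasing_tail[OF w, of "2*j+1"] by (simp add: numeral_eq_Suc)
  then show ?thesis using superdecreasing_pos[OF w, of "2*j+3"] by (simp add: renorm_def)
qed

lemma renorm_partial_sum: "superdecreasing w \<Longrightarrow> (\<Sum>j<n. renorm w j) \<le> w 1 - w (2 * n + 1)"
proof (induction n)
  case (Suc n)
  then show ?case
    using superdecreasing_decseq[OF Suc.prems, of "2*n+2"] by (simp add: renorm_def)
qed simp

lemma renorm_summable: "superdecreasing w \<Longrightarrow> summable (renorm w)"
proof (rule summableI_nonneg_bounded)
  fix n assume w: "superdecreasing w"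
  show "0 \<le> renorm w n" using renorm_pos[OF w, of n] by simp
  show "sum (renorm w) {..<n} \<le> w 1"
    using renorm_partial_sum[OF w, of n] superdecreasing_pos[OF w, of "2*n+1"] by simp
qed

lemma suminf_renorm_le: "superdecreasing w \<Longrightarrow> suminf (renorm w) \<le> w 1"
proof (rule suminf_le_const[OF renorm_summable])
  fix n assume w: "superdecreasing w"
  show "sum (renorm w) {..<n} \<le> w 1"
    using renorm_partial_sum[OF w, of n] superdecreasing_pos[OF w, of "2*n+1"] by simp
qed

lemma sums_pairs:
  fixes f :: "nat \<Rightarrow> 'a :: real_normed_vector"
  assumes "f sums s"
  shows "(\<lambda>j. f (2 * j) + f (2 * j + 1)) sums s"
  using sums_group[OF assms, of 2] by (simp add: mult.commute)

lemma renorm_superdecreasing: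
  assumes w: "superdecreasing w"
  shows "superdecreasing (renorm w)"
  unfolding superdecreasing_def
proof (intro conjI allI)
  show "summable (renorm w)" by (rule renorm_summable[OF w])
  fix j
  show "0 < renorm w j" by (rule renorm_pos[OF w])
  have sm: "summable (\<lambda>i. w (k + i))" for k by (rule superdecreasing_tail_summable[OF w])
  have pairs: "(\<lambda>i. w (2*j+3+2*i) + w (2*j+3+(2*i+1))) sums (\<Sum>i. w (2*j+3+i))"
    by (rule sums_pairs[OF summable_sums[OF sm]])
  have "(\<Sum>i. renorm w (Suc j + i)) \<le> (\<Sum>i. w (2*j+3+2*i) + w (2*j+3+(2*i+1)))"
  proof (rule suminf_le)
    show "renorm w (Suc j + i) \<le> w (2*j+3+2*i) + w (2*j+3+(2*i+1))" for i
      using superdecreasing_pos[OF w, of "2*j+3+(2*i+1)"]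
      by (simp add: renorm_def numeral_eq_Suc algebra_simps)
    show "summable (\<lambda>i. renorm w (Suc j + i))"
      using summable_ignore_initial_segment[OF renorm_summable[OF w], of "Suc j"]
      by (simp add: add.commute)
    show "summable (\<lambda>i. w (2*j+3+2*i) + w (2*j+3+(2*i+1)))"
      using pairs by (rule sums_summable)
  qed
  also have "\<dots> = (\<Sum>i. w (2*j+3+i))" using pairs by (rule sums_unique[symmetric])
  also have "\<dots> = (\<Sum>i. w (2*j+2+i)) - w (2*j+2)"
    using suminf_split_head[OF sm[of "2*j+2"]] by (simp add: numeral_eq_Suc)
  also have "\<dots> \<le> renorm w j"
    using superdecreasing_tail[OF w, of "2*j+1"] by (simp add: renorm_def)
  finally show "(\<Sum>i. renorm w (Suc j + i)) \<le> renorm w j" .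
qed

text \<open>
  The new total is at most \<open>w 1\<close> by telescoping, and \<open>2 w 1 \<le> w 0 + w 1 \<le> suminf w\<close>. This is what makes repeated
  renormalisation terminate.
\<close>

lemma suminf_renorm_half:
  assumes w: "superdecreasing w"
  shows "suminf (renorm w) \<le> suminf w / 2"
proof -
  have "(\<Sum>i\<in>{0,1}. w i) \<le> suminf w"
    by (rule sum_le_suminf) (auto simp: superdecreasing_summable[OF w] superdecreasing_pos[OF w] less_imp_le)
  then show ?thesis
    using suminf_renorm_le[OF w] superdecreasing_decseq[OF w, of 0] by simp
qed

text \<open>
  \<open>T\<close> is the image of \<open>T'\<close> under the substitution \<open>+ \<mapsto> + -\<close>, \<open>- \<mapsto> - +\<close>, whose fixed point is the
  Thue--Morse sequence.
\<close>

definition doubles :: "(nat \<Rightarrow> real) \<Rightarrow> (nat \<Rightarrow> real) \<Rightarrow> bool" where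
  "doubles T' T \<longleftrightarrow> (\<forall>n. T (2 * n) = T' n \<and> T (2 * n + 1) = - T' n)"

lemma doubles_sign_seq: "doubles T' T \<Longrightarrow> sign_seq T' \<Longrightarrow> sign_seq T"
  unfolding doubles_def sign_seq_def by (metis add.inverse_inverse evenE oddE)

text \<open>
  The entry right after an even position is its opposite and gives \<open>w 0\<close>; the remaining entries come
  in opposite pairs.
\<close>

lemma discord_doubles_even:
  assumes w: "superdecreasing w" and T': "sign_seq T'" and D: "doubles T' T"
  shows "discord w T (2 * n) = w 0 + discord (renorm w) T' n"
proof -
  have T: "sign_seq T" using doubles_sign_seq[OF D T'] .
  have e: "T (2 * i) = T' i" "T (Suc (2 * i)) = - T' i" for i using D by (simp_all add: doubles_def)
  have s: "summable (\<lambda>m. w m * T (Suc (2*n) + m))"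
    using summable_weighted_signs[OF w T, of 0 "Suc (2*n)"] by simp
  have "(\<lambda>m. w (Suc m) * T (Suc (2*n) + Suc m)) sums
        ((\<Sum>m. w m * T (Suc (2*n) + m)) - w 0 * T (Suc (2*n)))"
    using summable_sums[OF s] by (subst sums_Suc_iff) simp
  from sums_pairs[OF this]
  have "(\<lambda>j. w (Suc (2*j)) * T (2*(Suc n + j)) + w (2*j+2) * T (Suc (2*(Suc n+j)))) sums
        ((\<Sum>m. w m * T (Suc (2*n) + m)) - w 0 * T (Suc (2*n)))"
    by (simp add: algebra_simps numeral_eq_Suc)
  then have "(\<lambda>j. renorm w j * T' (Suc n + j)) sums
        ((\<Sum>m. w m * T (Suc (2*n) + m)) + w 0 * T' n)"
    by (simp only: e renorm_def) (simp add: algebra_simps)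
  then have "(\<Sum>j. renorm w j * T' (Suc n + j)) = (\<Sum>m. w m * T (Suc (2*n) + m)) + w 0 * T' n"
    by (rule sums_unique[symmetric])
  moreover have "T' n * T' n = 1" using sign_seqD[OF T', of n] by auto
  ultimately show ?thesis unfolding discord_def e
    by (simp add: algebra_simps)
qed

text \<open>
  The two entries after an odd position are opposite to each other. Whichever comes first, they and
  the tail contribute at most \<open>w 0\<close>.
\<close>

lemma discord_doubles_odd:
  assumes w: "superdecreasing w" and T': "sign_seq T'" and D: "doubles T' T"
  shows "discord w T (2 * n + 1) \<le> w 0"
proof -
  have T: "sign_seq T" using doubles_sign_seq[OF D T'] .
  have e: "T (2 * i) = T' i" "T (Suc (2 * i)) = - T' i" for i using D by (simp_all add: doubles_def)
  have "T (Suc (Suc (2*n))) = T' (Suc n)" "T (Suc (Suc (Suc (2*n)))) = - T' (Suc n)"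
    using e[of "Suc n"] by simp_all
  then show ?thesis
    using discord_cut[OF w T, of "Suc (2*n)" 1] sign_seqD[OF T', of n] sign_seqD[OF T', of "Suc n"]
      superdecreasing_decseq[OF w, of 0]
    by (auto simp: e)
qed

text \<open>
  The value is \<open>1\<close> or \<open>-1\<close> according to the parity of the number of binary digits \<open>1\<close> of the argument.
\<close>

fun thue_morse :: "nat \<Rightarrow> real" where
  "thue_morse n = (if n = 0 then 1 else (-1) ^ n * thue_morse (n div 2))"
declare thue_morse.simps [simp del]

text \<open>
  The image of the alternating sequence under \<open>k\<close> substitutions, of period \<open>2 ^ Suc k\<close>.
\<close>

fun tm_approx :: "nat \<Rightarrow> nat \<Rightarrow> real" where
  "tm_approx 0 n = (-1) ^ n"
| "tm_approx (Suc k) n = (-1) ^ n * tm_approx k (n div 2)"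

lemma thue_morse_0: "thue_morse 0 = 1"
  by (simp add: thue_morse.simps)

lemma thue_morse_rec: "thue_morse n = (-1) ^ n * thue_morse (n div 2)"
  by (cases "n = 0") (simp_all add: thue_morse.simps[of n] thue_morse.simps[of 0])

lemma thue_morse_doubles: "doubles thue_morse thue_morse"
  unfolding doubles_def by (auto simp: thue_morse_rec[of "2 * n" for n] thue_morse_rec[of "Suc (2 * n)" for n])

lemma thue_morse_sign: "sign_seq thue_morse"
  unfolding sign_seq_def
proof
  fix n show "thue_morse n = 1 \<or> thue_morse n = -1"
  proof (induction n rule: thue_morse.induct)
    case (1 n)
    then show ?case
      by (cases "n = 0") (auto simp: thue_morse_0 thue_morse.simps[of n] minus_one_power_iff)
  qed
qed

lemma tm_approx_doubles: "doubles (tm_approx k) (tm_approx (Suc k))"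
  by (simp add: doubles_def)

lemma tm_approx_sign: "sign_seq (tm_approx k)"
proof (induction k)
  case 0 show ?case by (simp add: sign_seq_def minus_one_power_iff)
next
  case (Suc k) then show ?case by (rule doubles_sign_seq[OF tm_approx_doubles])
qed

lemma tm_approx_start: "tm_approx k 0 = 1" "tm_approx k 1 = -1"
  by (induction k) simp_all

lemma tm_approx_periodic: "tm_approx k (n + 2 ^ Suc k * i) = tm_approx k n"
proof (induction k arbitrary: n)
  case (Suc k)
  have "(n + 2 ^ Suc (Suc k) * i) div 2 = n div 2 + 2 ^ Suc k * i" by simp
  moreover have "(-1::real) ^ (n + 2 ^ Suc (Suc k) * i) = (-1) ^ n"
    by (simp add: power_add power_mult)
  ultimately show ?case using Suc[of "n div 2"] by (simp only: tm_approx.simps)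
qed (simp add: power_add power_mult)

text \<open>
  By induction through the substitution: even positions inherit the claim, and odd positions stay
  below \<open>w 0\<close>, hence below the value at \<open>0\<close>.
\<close>

lemma discord_tm_approx_max:
  "superdecreasing w \<Longrightarrow> discord w (tm_approx k) n \<le> discord w (tm_approx k) 0"
proof (induction k arbitrary: w n)
  case 0
  have "summable (\<lambda>m. w m * (-1) ^ Suc m)"
    using summable_weighted_signs[OF 0 tm_approx_sign, of 0 0 1] by simp
  from suminf_mult[OF this, of "(-1) ^ n"]
  have "(\<Sum>m. w m * tm_approx 0 (Suc n + m)) = (-1) ^ n * (\<Sum>m. w m * tm_approx 0 (Suc 0 + m))"
    by (simp add: power_add algebra_simps)
  then have "discord w (tm_approx 0) n = discord w (tm_approx 0) 0"
    by (cases "even n") (simp_all add: discord_def)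
  then show ?case by (simp del: tm_approx.simps)
next
  case (Suc k)
  let ?d = "discord (renorm w) (tm_approx k)"
  note w' = renorm_superdecreasing[OF Suc.prems]
  have ev: "discord w (tm_approx (Suc k)) (2 * m) = w 0 + ?d m" for m
    by (rule discord_doubles_even[OF Suc.prems tm_approx_sign tm_approx_doubles])
  have z: "discord w (tm_approx (Suc k)) 0 = w 0 + ?d 0" using ev[of 0] by simp
  show ?case
  proof (cases "even n")
    case True
    then obtain m where "n = 2 * m" by (elim evenE)
    then show ?thesis using Suc.IH[OF w', of m] ev[of m] z by (simp del: tm_approx.simps)
  next
    case False
    then obtain m where "n = 2 * m + 1" by (elim oddE)
    then have "discord w (tm_approx (Suc k)) n \<le> w 0"
      using discord_doubles_odd[OF Suc.prems tm_approx_sign tm_approx_doubles] by simp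
    moreover have "0 \<le> ?d 0"
      using discord_nonneg[OF w' tm_approx_sign, of k 0] tm_approx_start[of k] by simp
    ultimately show ?thesis using z by linarith
  qed
qed

text \<open>
  The sequences arise by \<open>k\<close> substitutions from Thue--Morse and from the alternating sequence. So the gap
  for \<open>w\<close> equals the gap between those two for the \<open>k\<close> times renormalised weights, whose total is at most
  \<open>suminf w / 2 ^ k\<close>. There the gap is positive because the alternating sequence arises from a
  constant one by a substitution, and a constant sequence has negative discord, unlike Thue--Morse.
\<close>

lemma discord_tm_gap:
  assumes "superdecreasing w"
  shows "discord w (tm_approx k) 0 < discord w thue_morse 0"
    and "discord w thue_morse 0 - discord w (tm_approx k) 0 \<le> 2 * suminf w / 2 ^ k"
proof -
  have "discord w (tm_approx k) 0 < discord w thue_morse 0 \<and>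
        discord w thue_morse 0 - discord w (tm_approx k) 0 \<le> 2 * suminf w / 2 ^ k"
    using assms
  proof (induction k arbitrary: w)
    case 0
    note w' = renorm_superdecreasing[OF 0]
    have one: "sign_seq (\<lambda>_. 1)" by (simp add: sign_seq_def)
    \<comment> \<open>The alternating sequence is the image of a constant one.\<close>
    have "doubles (\<lambda>_. 1) (tm_approx 0)" by (simp add: doubles_def)
    from discord_doubles_even[OF 0 one this, of 0]
    have "discord w (tm_approx 0) 0 = w 0 - suminf (renorm w)"
      by (simp add: discord_def)
    moreover have "0 < suminf (renorm w)"
      by (rule suminf_pos[OF renorm_summable[OF 0]]) (rule renorm_pos[OF 0])
    moreover have "discord w thue_morse 0 = w 0 + discord (renorm w) thue_morse 0"
      using discord_doubles_even[OF 0 thue_morse_sign thue_morse_doubles, of 0] by simp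
    moreover have "0 \<le> discord (renorm w) thue_morse 0"
      using discord_nonneg[OF w' thue_morse_sign, of 0] thue_morse.simps[of 0] thue_morse.simps[of 1] by simp
    moreover have "\<bar>discord w thue_morse 0\<bar> \<le> suminf w" "\<bar>discord w (tm_approx 0) 0\<bar> \<le> suminf w"
      by (rule discord_bound[OF 0 thue_morse_sign] discord_bound[OF 0 tm_approx_sign])+
    ultimately show ?case by (simp del: tm_approx.simps)
  next
    case (Suc k)
    note w' = renorm_superdecreasing[OF Suc.prems]
    have "discord w (tm_approx (Suc k)) 0 = w 0 + discord (renorm w) (tm_approx k) 0"
      using discord_doubles_even[OF Suc.prems tm_approx_sign tm_approx_doubles, of k 0] by simp
    moreover have "discord w thue_morse 0 = w 0 + discord (renorm w) thue_morse 0"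
      using discord_doubles_even[OF Suc.prems thue_morse_sign thue_morse_doubles, of 0] by simp
    moreover have "2 * suminf (renorm w) / 2 ^ k \<le> 2 * suminf w / 2 ^ Suc k"
      using suminf_renorm_half[OF Suc.prems] by (simp add: field_simps)
    ultimately show ?case using Suc.IH[OF w'] by linarith
  qed
  then show "discord w (tm_approx k) 0 < discord w thue_morse 0"
    and "discord w thue_morse 0 - discord w (tm_approx k) 0 \<le> 2 * suminf w / 2 ^ k" by auto
qed

text \<open>
  Peel off one or two substitutions and bound the rest by its leading weight.
\<close>

lemma discord_thue_morse_le:
  assumes w: "superdecreasing w"
  shows "discord w thue_morse 0 \<le> w 0 + w 1"
    and "discord w thue_morse 0 \<le> w 0 + w 1 - w 2 + w 3 - w 4"
proof -
  note w' = renorm_superdecreasing[OF w]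
  note w'' = renorm_superdecreasing[OF w']
  have 1: "discord v thue_morse 0 = v 0 + discord (renorm v) thue_morse 0"
    if "superdecreasing v" for v
    using discord_doubles_even[OF that thue_morse_sign thue_morse_doubles, of 0] by simp
  have 2: "discord (renorm v) thue_morse 0 \<le> v 1" if "superdecreasing v" for v
    using discord_bound[OF renorm_superdecreasing[OF that] thue_morse_sign, of 0]
      suminf_renorm_le[OF that] by simp
  show "discord w thue_morse 0 \<le> w 0 + w 1" using 1[OF w] 2[OF w] by simp
  show "discord w thue_morse 0 \<le> w 0 + w 1 - w 2 + w 3 - w 4"
    using 1[OF w] 1[OF w'] 2[OF w'] by (simp add: renorm_def numeral_eq_Suc)
qed

text \<open>
  Up to a global sign, \<open>+ - -\<close> cannot be followed by \<open>-\<close>, nor by \<open>+ - -\<close>, nor by \<open>+ - + -\<close>: each continuation already forces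
  \<open>discord w T n\<close> up to one of the bounds on the Thue--Morse value.
\<close>

lemma forbidden_patterns:
  assumes w: "superdecreasing w" and T: "sign_seq T"
    and low: "discord w T n < discord w thue_morse 0"
    and pre: "T n \<noteq> T (n + 1)" "T (n + 1) = T (n + 2)"
  shows "T (n + 2) \<noteq> T (n + 3)"
    and "T (n + 3) \<noteq> T (n + 4) \<Longrightarrow> T (n + 4) \<noteq> T (n + 5)"
    and "T (n + 3) \<noteq> T (n + 4) \<Longrightarrow> T (n + 5) = T (n + 6)"
proof -
  note tm = discord_thue_morse_le[OF w]
  have nz: "T n * T n = 1" using sign_seqD[OF T, of n] by auto
  have sg: "T (n + i) = T n \<or> T (n + i) = - T n" for i
    using sign_seqD[OF T, of n] sign_seqD[OF T, of "n + i"] by auto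
  have "T n \<noteq> 0" using nz by auto
  \<comment> \<open>\<open>q i = 1\<close> means that the entry at distance \<open>i + 1\<close> differs from \<open>T n\<close>.\<close>
  define q where "q i = - T n * T (n + Suc i)" for i
  have cut: "discord w T n \<ge> (\<Sum>m<Suc k. w m * q m) - w k" for k
    using discord_cut[OF w T, of n k] by (simp add: q_def)
  have q01: "q 0 = 1" "q 1 = 1" using sg[of 1] sg[of 2] pre nz by (auto simp: q_def numeral_eq_Suc)
  have qq: "q i = 1 \<or> q i = -1" for i using sg[of "Suc i"] nz by (auto simp: q_def)
  have eq: "T (n + Suc i) = T (n + Suc j) \<longleftrightarrow> q i = q j" for i j
    using \<open>T n \<noteq> 0\<close> by (simp add: q_def)
  have q2: "q 2 = -1"
    using cut[of 2] low tm q01 qq[of 2] by (auto simp: numeral_eq_Suc)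
  then show "T (n + 2) \<noteq> T (n + 3)" using eq[of 1 2] q01 by (simp add: numeral_eq_Suc)
  assume "T (n + 3) \<noteq> T (n + 4)"
  then have q3: "q 3 = 1" using eq[of 2 3] q2 qq[of 3] by (auto simp: numeral_eq_Suc)
  have q4: "q 4 = -1"
    using cut[of 4] low tm q01 q2 q3 qq[of 4] superdecreasing_pos[OF w, of 4]
    by (auto simp: numeral_eq_Suc)
  then show "T (n + 4) \<noteq> T (n + 5)" using eq[of 3 4] q3 by (simp add: numeral_eq_Suc)
  have "q 5 = -1"
    using cut[of 5] low tm q01 q2 q3 q4 qq[of 5] by (auto simp: numeral_eq_Suc)
  then show "T (n + 5) = T (n + 6)" using eq[of 4 5] q4 by (simp add: numeral_eq_Suc)
qed

text \<open>
  By the forbidden patterns, after \<open>+ - -\<close> the next repeated sign occurs two or four positions later.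
  So all repetitions occur at positions of one parity, and cutting there gives pairs of opposite signs.
\<close>

lemma desubstitution:
  assumes w: "superdecreasing w" and T: "sign_seq T"
    and low: "\<And>n. discord w T (N + n) < discord w thue_morse 0"
    and pre: "T N \<noteq> T (N + 1)" "T (N + 1) = T (N + 2)"
  shows "doubles (\<lambda>n. T (N + 2 * n)) (\<lambda>n. T (N + n))"
proof -
  \<comment> \<open>\<open>D k\<close> says that a repetition starts right after position \<open>N + 2 k\<close>.\<close>
  define D where "D k \<longleftrightarrow> T (N+2*k) \<noteq> T (N+2*k+1) \<and> T (N+2*k+1) = T (N+2*k+2)" for k
  have step: "D (Suc k) \<or> (D (Suc (Suc k)) \<and> T (N+2*Suc k) \<noteq> T (N+2*Suc k+1))" if "D k" for k
  proof -
    have lo: "discord w T (N+2*k) < discord w thue_morse 0" using low[of "2*k"] .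
    note f = forbidden_patterns[OF w T lo]
    have d: "T (N+2*k) \<noteq> T (N+2*k+1)" "T (N+2*k+1) = T (N+2*k+2)" using that by (auto simp: D_def)
    have "D (Suc k) \<longleftrightarrow> T (N+2*k+2) \<noteq> T (N+2*k+3) \<and> T (N+2*k+3) = T (N+2*k+4)"
      "D (Suc (Suc k)) \<longleftrightarrow> T (N+2*k+4) \<noteq> T (N+2*k+5) \<and> T (N+2*k+5) = T (N+2*k+6)"
      "T (N+2*Suc k) = T (N+2*k+2)" "T (N+2*Suc k+1) = T (N+2*k+3)"
      by (simp_all add: D_def numeral_eq_Suc)
    then show ?thesis using f[OF d] by (cases "T (N+2*k+3) = T (N+2*k+4)") simp_all
  qed
  have Q: "D k \<or> (D (Suc k) \<and> T (N+2*k) \<noteq> T (N+2*k+1))" for k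
  proof (induction k)
    case 0 show ?case using pre by (simp add: D_def)
  next
    case (Suc k)
    then show ?case using step[of k] by argo
  qed
  have "T (N+2*k) \<noteq> T (N+2*k+1)" for k using Q[of k] unfolding D_def by argo
  then have "T (N+2*k+1) = - T (N+2*k)" for k
    using sign_seqD[OF T, of "N+2*k"] sign_seqD[OF T, of "N+2*k+1"] by (metis add.inverse_inverse)
  then show ?thesis by (simp add: doubles_def)
qed

text \<open>
  Induction on \<open>j\<close>: desubstitution keeps the margin \<open>\<eta>\<close> and halves the total weight. Once the total is below
  \<open>\<eta>\<close>, the discord is eventually negative, which excludes any further change of sign. If
  \<open>T'\<close> is eventually constant, \<open>T\<close> eventually alternates, which is the case \<open>k = 0\<close>.
\<close>

lemma low_discord_dichotomy_aux:
  assumes "superdecreasing w" "sign_seq T" "0 < \<eta>" "suminf w < 2 ^ j * \<eta>"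
    and "\<forall>\<^sub>F n in sequentially. discord w T n \<le> discord w thue_morse 0 - \<eta>"
  shows "(\<exists>N. \<forall>n\<ge>N. T n = T N) \<or> (\<exists>N k. \<forall>n. T (N + n) = T N * tm_approx k n)"
  using assms
proof (induction j arbitrary: w T)
  case 0
  obtain N where N: "\<And>n. n \<ge> N \<Longrightarrow> discord w T n \<le> discord w thue_morse 0 - \<eta>"
    using 0(5) by (auto simp: eventually_sequentially)
  have "discord w T n < 0" if "n \<ge> N" for n
    using N[OF that] discord_bound[OF 0(1) thue_morse_sign, of 0] 0(4) by simp
  then have "T (Suc n) = T n" if "n \<ge> N" for n
    using discord_nonneg[OF 0(1) 0(2), of n] that by (metis not_le)
  note const = this
  have "T n = T N" if "n \<ge> N" for n
    using that by (induction n rule: dec_induct) (auto simp: const)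
  then show ?case by blast
next
  case (Suc j)
  note w = Suc.prems(1) and T = Suc.prems(2) and \<eta> = Suc.prems(3)
  obtain N0 where N0: "\<And>n. n \<ge> N0 \<Longrightarrow> discord w T n \<le> discord w thue_morse 0 - \<eta>"
    using Suc.prems(5) by (auto simp: eventually_sequentially)
  show ?case
  proof (cases "\<exists>N\<ge>N0. T N \<noteq> T (N+1) \<and> T (N+1) = T (N+2)")
    case True
    then obtain N where N: "N \<ge> N0" "T N \<noteq> T (N+1)" "T (N+1) = T (N+2)" by blast
    define T0 where "T0 n = T (N + n)" for n
    define T' where "T' n = T (N + 2 * n)" for n
    have D: "doubles T' T0" unfolding T'_def T0_def
    proof (rule desubstitution[OF w T _ N(2,3)])
      show "discord w T (N + n) < discord w thue_morse 0" for n
        using N0[of "N + n"] N(1) \<eta> by simp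
    qed
    have T': "sign_seq T'" using T by (simp add: sign_seq_def T'_def)
    note w' = renorm_superdecreasing[OF w]
    have "discord (renorm w) T' n \<le> discord (renorm w) thue_morse 0 - \<eta>" for n
    proof -
      have "w 0 + discord (renorm w) T' n = discord w T0 (2 * n)"
        using discord_doubles_even[OF w T' D] by simp
      also have "\<dots> = discord w T (N + 2 * n)"
        by (simp add: discord_def T0_def add.assoc)
      also have "\<dots> \<le> discord w thue_morse 0 - \<eta>" using N0 N(1) by simp
      also have "discord w thue_morse 0 = w 0 + discord (renorm w) thue_morse 0"
        using discord_doubles_even[OF w thue_morse_sign thue_morse_doubles, of 0] by simp
      finally show ?thesis by simp
    qed
    then have "\<forall>\<^sub>F n in sequentially. discord (renorm w) T' n \<le> discord (renorm w) thue_morse 0 - \<eta>"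
      by simp
    moreover have "suminf (renorm w) < 2 ^ j * \<eta>"
      using suminf_renorm_half[OF w] Suc.prems(4) by simp
    ultimately have split: "(\<exists>M. \<forall>n\<ge>M. T' n = T' M) \<or> (\<exists>M k. \<forall>n. T' (M + n) = T' M * tm_approx k n)"
      using Suc.IH[OF w' T' \<eta>] by blast
    have T0: "T0 n = (-1) ^ n * T' (n div 2)" for n
    proof (cases "even n")
      case True
      then obtain m where "n = 2 * m" by (elim evenE)
      then show ?thesis using D by (simp add: doubles_def)
    next
      case False
      then obtain m where "n = 2 * m + 1" by (elim oddE)
      then show ?thesis using D by (simp add: doubles_def)
    qed
    have dec: "T (N + 2 * M + n) = (-1) ^ n * T' (M + n div 2)" for M n
      using T0[of "2 * M + n"] by (simp add: T0_def add.assoc power_add)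
    from split consider (const) M where "\<And>n. n \<ge> M \<Longrightarrow> T' n = T' M"
      | (per) M k where "\<And>n. T' (M + n) = T' M * tm_approx k n" by blast
    then show ?thesis
    proof cases
      case const
      have "T (N + 2 * M + n) = T (N + 2 * M) * tm_approx 0 n" for n
        using dec[of M n] const[of "M + n div 2"] by (simp add: T'_def)
      then show ?thesis by (intro disjI2 exI allI)
    next
      case per
      have "T (N + 2 * M + n) = T (N + 2 * M) * tm_approx (Suc k) n" for n
        using dec[of M n] per[of "n div 2"] by (simp add: T'_def)
      then show ?thesis by (intro disjI2 exI allI)
    qed
  next
    case False
    then have alt: "T (Suc n) \<noteq> T (Suc (Suc n))" if "n \<ge> N0" "T n \<noteq> T (Suc n)" for n
      using that by auto
    show ?thesis
    proof (cases "\<exists>N\<ge>N0. T N \<noteq> T (Suc N)")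
      case True
      then obtain N where N: "N \<ge> N0" "T N \<noteq> T (Suc N)" by blast
      have ne: "T (N + n) \<noteq> T (Suc (N + n))" for n
      proof (induction n)
        case (Suc n)
        then show ?case using alt[of "N + n"] N(1) by simp
      qed (use N in simp)
      have "T (N + n) = T N * tm_approx 0 n" for n
      proof (induction n)
        case (Suc n)
        have "T (Suc (N + n)) = - T (N + n)"
          using ne[of n] sign_seqD[OF T, of "N+n"] sign_seqD[OF T, of "Suc (N+n)"] by auto
        with Suc show ?case by simp
      qed simp
      then show ?thesis by (intro disjI2 exI allI)
    next
      case False
      then have const: "T (Suc n) = T n" if "n \<ge> N0" for n
        using that by metis
      have "T n = T N0" if "n \<ge> N0" for n
        using that by (induction n rule: dec_induct) (auto simp: const)
      then show ?thesis by blast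
    qed
  qed
qed

lemma low_discord_dichotomy:
  assumes "superdecreasing w" "sign_seq T" "0 < \<eta>"
    and "\<forall>\<^sub>F n in sequentially. discord w T n \<le> discord w thue_morse 0 - \<eta>"
  shows "(\<exists>N. \<forall>n\<ge>N. T n = T N) \<or> (\<exists>N k. \<forall>n. T (N + n) = T N * tm_approx k n)"
proof -
  obtain j :: nat where "suminf w / \<eta> < 2 ^ j" using real_arch_pow[of 2] by auto
  then have "suminf w < 2 ^ j * \<eta>" using assms(3) by (simp add: field_simps)
  from low_discord_dichotomy_aux[OF assms(1-3) this assms(4)] show ?thesis .
qed

section \<open>Upper limits of window sums of integer sequences\<close>

definition halving :: "(nat \<Rightarrow> real) \<Rightarrow> bool" where
  "halving h \<longleftrightarrow> h 0 = 1 \<and> (\<forall>m. 0 < h m \<and> 2 * h (Suc m) \<le> h m)"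

definition drops :: "(nat \<Rightarrow> real) \<Rightarrow> nat \<Rightarrow> real" where
  "drops h m = h m - h (Suc m)"

definition window_sum :: "(nat \<Rightarrow> real) \<Rightarrow> (nat \<Rightarrow> int) \<Rightarrow> nat \<Rightarrow> real" where
  "window_sum h s n = (\<Sum>m. h m * of_int (s (n + m)))"

text \<open>
  The stronger bound, with the term \<open>h (k + n)\<close> subtracted, is what the induction needs.
\<close>

lemma halving_tail_partial:
  assumes "halving h"
  shows "(\<Sum>j<n. h (Suc k + j)) \<le> h k - h (k + n)"
proof (induction n)
  case (Suc n)
  have "2 * h (Suc (k + n)) \<le> h (k + n)" using assms by (simp add: halving_def)
  with Suc show ?case by simp
qed simp

lemma halving_summable:
  assumes "halving h"
  shows "summable (\<lambda>j. h (k + j))"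
proof -
  have "summable (\<lambda>j. h (Suc 0 + j))"
  proof (rule summableI_nonneg_bounded)
    fix n
    show "0 \<le> h (Suc 0 + n)" using assms by (simp add: halving_def less_imp_le)
    show "(\<Sum>j<n. h (Suc 0 + j)) \<le> h 0"
      using halving_tail_partial[OF assms, of 0 n] assms by (simp add: halving_def) (smt (verit))
  qed
  then have "summable h" by (simp add: summable_Suc_iff)
  from summable_ignore_initial_segment[OF this, of k] show ?thesis by (simp add: add.commute)
qed

lemma halving_tail:
  assumes "halving h"
  shows "(\<Sum>j. h (Suc k + j)) \<le> h k"
proof (rule suminf_le_const[OF halving_summable[OF assms]])
  fix n show "(\<Sum>j<n. h (Suc k + j)) \<le> h k"
    using halving_tail_partial[OF assms, of k n] assms by (simp add: halving_def) (smt (verit))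
qed

lemma sums_drops:
  assumes "halving h"
  shows "(\<lambda>j. drops h (k + j)) sums h k"
proof -
  have "(\<lambda>j. h (k + j)) \<longlonglongrightarrow> 0" by (rule summable_LIMSEQ_zero[OF halving_summable[OF assms]])
  from telescope_sums'[OF this] show ?thesis by (simp add: drops_def)
qed

lemma drops_superdecreasing:
  assumes "halving h"
  shows "superdecreasing (drops h)"
  unfolding superdecreasing_def
proof (intro conjI allI)
  show "summable (drops h)" using sums_drops[OF assms, of 0] by (simp add: sums_iff)
  fix m
  have "0 < h m" "0 < h (Suc m)" "2 * h (Suc m) \<le> h m" using assms by (auto simp: halving_def)
  then show "0 < drops h m" by (simp add: drops_def)
  show "(\<Sum>j. drops h (Suc m + j)) \<le> drops h m"
    using sums_unique[OF sums_drops[OF assms, of "Suc m"]] \<open>2 * h (Suc m) \<le> h m\<close>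
    by (simp add: drops_def)
qed

lemma summable_weighted_bounded:
  fixes c z :: "nat \<Rightarrow> real"
  assumes "summable c" "\<And>m. 0 \<le> c m" "\<And>m. \<bar>z m\<bar> \<le> M"
  shows "summable (\<lambda>m. c m * z m)" "\<bar>\<Sum>m. c m * z m\<bar> \<le> M * suminf c"
proof -
  have b: "\<bar>c m * z m\<bar> \<le> M * c m" for m
    using mult_left_mono[OF assms(3)[of m] assms(2)[of m]] assms(2)[of m]
    by (simp add: abs_mult mult.commute)
  have sM: "summable (\<lambda>m. M * c m)" by (rule summable_mult[OF assms(1)])
  have sa: "summable (\<lambda>m. \<bar>c m * z m\<bar>)"
    by (rule summable_comparison_test'[OF sM]) (use b in simp)
  then show "summable (\<lambda>m. c m * z m)" by (rule summable_rabs_cancel)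
  have "\<bar>\<Sum>m. c m * z m\<bar> \<le> (\<Sum>m. \<bar>c m * z m\<bar>)" by (rule summable_rabs[OF sa])
  also have "\<dots> \<le> (\<Sum>m. M * c m)" by (rule suminf_le[OF b sa sM])
  also have "\<dots> = M * suminf c" by (rule suminf_mult[OF assms(1)])
  finally show "\<bar>\<Sum>m. c m * z m\<bar> \<le> M * suminf c" .
qed

lemma window_sum_split:
  assumes h: "halving h" and b: "\<And>m. \<bar>s m\<bar> \<le> B"
  shows "window_sum h s n = (\<Sum>m<k. h m * of_int (s (n + m))) + (\<Sum>m. h (k + m) * of_int (s (n + k + m)))"
proof -
  have "\<bar>real_of_int (s (n + m))\<bar> \<le> of_int B" for m using b[of "n+m"] by linarith
  then have "summable (\<lambda>m. h m * of_int (s (n + m)))"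
    using halving_summable[OF h, of 0] h by (intro summable_weighted_bounded[where M="of_int B"]) (auto simp: halving_def less_imp_le)
  from suminf_split_initial_segment[OF this, of k] show ?thesis
    by (simp add: window_sum_def algebra_simps)
qed

lemma tail_le:
  assumes h: "halving h" and b: "\<And>m. m \<ge> n \<Longrightarrow> \<bar>s m\<bar> \<le> (M::int)"
  shows "\<bar>\<Sum>m. h (k + m) * of_int (s (n + m))\<bar> \<le> of_int M * (\<Sum>m. h (k + m))"
proof (rule summable_weighted_bounded(2)[OF halving_summable[OF h]])
  show "0 \<le> h (k + m)" for m using h by (simp add: halving_def less_imp_le)
  show "\<bar>real_of_int (s (n + m))\<bar> \<le> of_int M" for m using b[of "n+m"] by linarith
qed

text \<open>
  Let \<open>M\<close> be the largest modulus that occurs infinitely often, and let \<open>H\<close> be the sum of \<open>h\<close>. Suppose that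
  \<open>M \<ge> 2\<close>, and look at a late digit of modulus \<open>M\<close>. If \<open>H \<le> 3/2\<close>, the other digits cancel at most half of it in the window
  sum \<open>y n\<close>. If \<open>H > 3/2\<close>, consider \<open>y n - y (n + 1) / 2\<close> instead: in it the later digits have nonpositive
  weights of total modulus \<open>1 - H / 2 < 1/4\<close>. Both cases contradict \<open>\<bar>y\<bar> < 1\<close>.
\<close>

lemma eventually_abs_le_1:
  assumes h: "halving h" and b: "\<And>m. \<bar>s m\<bar> \<le> B"
    and y: "\<forall>\<^sub>F n in sequentially. \<bar>window_sum h s n\<bar> < 1"
  shows "\<forall>\<^sub>F n in sequentially. \<bar>s n\<bar> \<le> 1"
proof (rule ccontr)
  assume no: "\<not> ?thesis"
  let ?P = "\<lambda>M::nat. \<forall>\<^sub>F n in sequentially. \<bar>s n\<bar> \<le> int M"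
  define M where "M = (LEAST M. ?P M)"
  have "?P (nat B)"
  proof (rule always_eventually, rule allI)
    fix n show "\<bar>s n\<bar> \<le> int (nat B)" using b[of n] by linarith
  qed
  then have PM: "?P M" unfolding M_def by (rule LeastI)
  have "M \<ge> 2"
  proof (rule ccontr)
    assume "\<not> 2 \<le> M"
    then have "?P 1" by (intro eventually_mono[OF PM]) auto
    with no show False by simp
  qed
  have "\<not> ?P (M - 1)" using not_less_Least[of "M - 1" ?P] \<open>M \<ge> 2\<close> unfolding M_def[symmetric] by simp
  obtain N where N: "\<And>n. n \<ge> N \<Longrightarrow> \<bar>s n\<bar> \<le> int M" "\<And>n. n \<ge> N \<Longrightarrow> \<bar>window_sum h s n\<bar> < 1"
    using eventually_conj[OF PM y] unfolding eventually_sequentially by blast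
  obtain n where n: "n \<ge> N" "\<not> \<bar>s n\<bar> \<le> int (M - 1)"
    using \<open>\<not> ?P (M - 1)\<close> unfolding eventually_sequentially by blast
  then have sn: "\<bar>s n\<bar> = int M" using N(1)[OF n(1)] by linarith
  then have sn': "\<bar>real_of_int (s n)\<bar> = real M" by linarith
  have h0: "h 0 = 1" using h by (simp add: halving_def)
  define H where "H = suminf h"
  have sh: "summable h" using halving_summable[OF h, of 0] by simp
  have H1: "(\<Sum>m. h (1 + m)) = H - 1"
    using suminf_split_head[OF sh] h0 by (simp add: H_def)
  have M2: "real M \<ge> 2" using \<open>M \<ge> 2\<close> by simp
  show False
  proof (cases "H \<le> 3/2")
    case True
    have "window_sum h s n = of_int (s n) + (\<Sum>m. h (1 + m) * of_int (s (n + 1 + m)))"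
      using window_sum_split[where s=s and n=n and k=1, OF h b] h0 by simp
    moreover have "\<bar>\<Sum>m. h (1 + m) * of_int (s (n + 1 + m))\<bar> \<le> real M * (H - 1)"
      using tail_le[OF h, where n="n+1" and k=1 and M="int M"] N(1) n(1) H1 by simp
    moreover have "real M * (H - 1) \<le> real M * (1/2)" using True by (intro mult_left_mono) auto
    ultimately have "\<bar>window_sum h s n\<bar> \<ge> 1" using sn' M2 by linarith
    then show False using N(2)[OF n(1)] by simp
  next
    case False
    \<comment> \<open>Minus the weights of the later digits in \<open>y n - y (n + 1) / 2\<close>, where \<open>y\<close> is the window sum.\<close>
    define d where "d m = h m / 2 - h (1 + m)" for m
    have d0: "0 \<le> d m" for m
    proof -
      have "2 * h (Suc m) \<le> h m" using h by (simp add: halving_def)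
      then show ?thesis by (simp add: d_def)
    qed
    have sh1: "summable (\<lambda>m. h (1 + m))" by (rule halving_summable[OF h])
    have dsum: "d sums (H / 2 - (H - 1))"
      unfolding d_def H_def using sums_diff[OF sums_divide[OF summable_sums[OF sh], of 2] summable_sums[OF sh1]] H1
      by (simp add: H_def)
    have bd: "\<bar>real_of_int (s (n + 1 + m))\<bar> \<le> real M" for m using N(1)[of "n+1+m"] n(1) by linarith
    have s1: "summable (\<lambda>m. h m * of_int (s (n + 1 + m)))"
      by (rule summable_weighted_bounded[OF sh _ bd]) (use h in \<open>simp add: halving_def less_imp_le\<close>)
    have s2: "summable (\<lambda>m. h (1 + m) * of_int (s (n + 1 + m)))"
      by (rule summable_weighted_bounded[OF sh1 _ bd]) (use h in \<open>simp add: halving_def less_imp_le\<close>)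
    have "(\<Sum>m. d m * of_int (s (n + 1 + m)))
        = (\<Sum>m. h m * of_int (s (n + 1 + m)) / 2 - h (1 + m) * of_int (s (n + 1 + m)))"
      by (simp add: d_def algebra_simps)
    also have "\<dots> = (\<Sum>m. h m * of_int (s (n + 1 + m))) / 2 - (\<Sum>m. h (1 + m) * of_int (s (n + 1 + m)))"
      using suminf_diff[OF summable_divide[OF s1, of 2] s2] suminf_divide[OF s1, of 2] by simp
    also have "\<dots> = of_int (s n) - (window_sum h s n - window_sum h s (n + 1) / 2)"
      using window_sum_split[where s=s and n=n and k=1, OF h b] h0 by (simp add: window_sum_def)
    finally have v: "window_sum h s n - window_sum h s (n + 1) / 2
        = of_int (s n) - (\<Sum>m. d m * of_int (s (n + 1 + m)))" by simp
    have "\<bar>\<Sum>m. d m * of_int (s (n + 1 + m))\<bar> \<le> real M * suminf d"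
      by (rule summable_weighted_bounded(2)[OF sums_summable[OF dsum] d0 bd])
    also have "\<dots> \<le> real M * (1/4)"
      using False sums_unique[OF dsum] by (intro mult_left_mono) auto
    finally show False
      using v sn' M2 N(2)[OF n(1)] N(2)[of "n+1"] n(1) by linarith
  qed
qed

text \<open>
  Everything after the second of the two equal digits has weight at most \<open>h k\<close>, which the second
  digit compensates.
\<close>

lemma equal_neighbours_large:
  assumes h: "halving h" and b: "\<And>m. \<bar>s m\<bar> \<le> 1" and "s n \<noteq> 0" "k > 0"
    and zero: "\<And>i. 0 < i \<Longrightarrow> i < k \<Longrightarrow> s (n + i) = 0" and eq: "s (n + k) = s n"
  shows "1 \<le> \<bar>window_sum h s n\<bar>"
proof -
  obtain k' where k: "k = Suc k'" using \<open>k > 0\<close> by (cases k) auto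
  have h0: "h 0 = 1" using h by (simp add: halving_def)
  have "(\<Sum>m<k'. h (Suc m) * of_int (s (n + Suc m))) = 0"
    by (rule sum.neutral) (use zero[of "Suc _"] k in simp)
  then have "(\<Sum>m<Suc k. h m * of_int (s (n + m))) = of_int (s n) * (1 + h k)"
    unfolding k by (subst sum.lessThan_Suc, subst sum.lessThan_Suc_shift)
      (use eq k h0 in \<open>simp add: algebra_simps\<close>)
  then have "window_sum h s n = of_int (s n) * (1 + h k) + (\<Sum>m. h (Suc k + m) * of_int (s (n + Suc k + m)))"
    using window_sum_split[where s=s and n=n and k="Suc k", OF h b] by simp
  moreover have "\<bar>\<Sum>m. h (Suc k + m) * of_int (s (n + Suc k + m))\<bar> \<le> h k"
    using tail_le[where s=s and n="n + Suc k" and k="Suc k" and M=1, OF h b] halving_tail[OF h, of k] by simp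
  moreover have "\<bar>real_of_int (s n) * (1 + h k)\<bar> = 1 + h k"
  proof -
    have "\<bar>s n\<bar> = 1" using b[of n] \<open>s n \<noteq> 0\<close> by linarith
    then have "\<bar>real_of_int (s n)\<bar> = 1" by linarith
    moreover have "0 < h k" using h by (simp add: halving_def)
    ultimately show ?thesis by (simp add: abs_mult)
  qed
  ultimately show ?thesis by linarith
qed

text \<open>
  \<open>T n\<close> is the first nonzero digit at or after \<open>n\<close>.
\<close>

lemma alternating_primitive:
  fixes s :: "nat \<Rightarrow> int"
  assumes b: "\<And>m. \<bar>s m\<bar> \<le> 1" and inf: "\<And>n. \<exists>m\<ge>n. s m \<noteq> 0"
    and alt: "\<And>n k. s n \<noteq> 0 \<Longrightarrow> 0 < k \<Longrightarrow> (\<And>i. 0 < i \<Longrightarrow> i < k \<Longrightarrow> s (n + i) = 0) \<Longrightarrow> s (n + k) \<noteq> s n"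
  shows "\<exists>T. sign_seq T \<and> (\<forall>n. of_int (s n) = (T n - T (Suc n)) / 2)"
proof -
  define nx where "nx n = (LEAST m. n \<le> m \<and> s m \<noteq> 0)" for n
  have nx: "n \<le> nx n \<and> s (nx n) \<noteq> 0" for n
    using LeastI_ex[OF inf[of n]] by (simp add: nx_def)
  have nx_min: "s m = 0" if "n \<le> m" "m < nx n" for n m
    using not_less_Least[of m "\<lambda>m. n \<le> m \<and> s m \<noteq> 0"] that by (auto simp: nx_def)
  have pm: "s m = 1 \<or> s m = -1" if "s m \<noteq> 0" for m using b[of m] that by linarith
  define T where "T n = real_of_int (s (nx n))" for n
  have T: "sign_seq T" unfolding sign_seq_def
  proof
    fix n show "T n = 1 \<or> T n = - 1" using pm[of "nx n"] nx[of n] by (auto simp: T_def)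
  qed
  have "of_int (s n) = (T n - T (Suc n)) / 2" for n
  proof (cases "s n = 0")
    case True
    have "nx n = nx (Suc n)" unfolding nx_def
      by (rule arg_cong[where f=Least]) (use True in \<open>metis Suc_le_eq le_less\<close>)
    then show ?thesis using True by (simp add: T_def)
  next
    case False
    then have "nx n = n" using nx_min[of n n] nx[of n] by (metis le_less order_refl)
    define k where "k = nx (Suc n) - n"
    have k: "nx (Suc n) = n + k" "0 < k" using nx[of "Suc n"] by (auto simp: k_def)
    have "s (n + k) \<noteq> s n"
      by (rule alt[OF False k(2)]) (use nx_min[of "Suc n"] k in auto)
    moreover have "s (n + k) \<noteq> 0" using nx[of "Suc n"] k by simp
    ultimately have "s (n + k) = - s n" using pm[of n] pm[of "n + k"] False by auto
    then show ?thesis using \<open>nx n = n\<close> k by (simp add: T_def)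
  qed
  with T show ?thesis by blast
qed

text \<open>
  Summation by parts: the differences of \<open>T\<close> are moved to the weights.
\<close>

lemma window_sum_primitive:
  assumes h: "halving h" and T: "sign_seq T" and s: "\<And>n. of_int (s n) = (T n - T (Suc n)) / 2"
  shows "window_sum h s n = T n * ((1 + discord (drops h) T n) / 2)"
proof -
  have sh: "summable h" using halving_summable[OF h, of 0] by simp
  have sh1: "summable (\<lambda>m. h (Suc m))" using halving_summable[OF h, of 1] by simp
  have h0: "h 0 = 1" and pos: "\<And>m. 0 \<le> h m" using h by (auto simp: halving_def less_imp_le)
  have b: "\<bar>T m\<bar> \<le> 1" for m using sign_seqD[OF T, of m] by auto
  have s0: "summable (\<lambda>m. h m * T (n + m))" by (rule summable_weighted_bounded[OF sh pos b])
  have s1: "summable (\<lambda>m. h m * T (Suc n + m))" by (rule summable_weighted_bounded[OF sh pos b])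
  have s2: "summable (\<lambda>m. h (Suc m) * T (Suc n + m))" by (rule summable_weighted_bounded[OF sh1 pos b])
  have "window_sum h s n = (\<Sum>m. (h m * T (n + m) - h m * T (Suc n + m)) / 2)"
    by (simp add: window_sum_def s algebra_simps)
  also have "\<dots> = ((\<Sum>m. h m * T (n + m)) - (\<Sum>m. h m * T (Suc n + m))) / 2"
    using suminf_divide[OF summable_diff[OF s0 s1], of 2] suminf_diff[OF s0 s1] by simp
  also have "(\<Sum>m. h m * T (n + m)) = T n + (\<Sum>m. h (Suc m) * T (Suc n + m))"
    using suminf_split_head[OF s0] h0 by simp
  also have "(\<Sum>m. h m * T (Suc n + m)) = (\<Sum>m. drops h m * T (Suc n + m)) + (\<Sum>m. h (Suc m) * T (Suc n + m))"
    using suminf_diff[OF s1 s2] by (simp add: drops_def algebra_simps)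
  finally have "window_sum h s n = (T n - (\<Sum>m. drops h m * T (Suc n + m))) / 2" by simp
  moreover have "T n * T n = 1" using sign_seqD[OF T, of n] by auto
  ultimately show ?thesis
    unfolding discord_def by (simp add: algebra_simps diff_divide_distrib flip: mult.assoc)
qed

lemma abs_window_sum_primitive:
  assumes h: "halving h" and T: "sign_seq T" and s: "\<And>n. of_int (s n) = (T n - T (Suc n)) / 2"
  shows "\<bar>window_sum h s n\<bar> = (1 + discord (drops h) T n) / 2"
    and "\<bar>window_sum h s n\<bar> \<le> 1"
proof -
  have "\<bar>discord (drops h) T n\<bar> \<le> 1"
    using discord_bound[OF drops_superdecreasing[OF h] T, of n] sums_unique[OF sums_drops[OF h, of 0]] h
    by (simp add: halving_def)
  moreover have "\<bar>T n\<bar> = 1" using sign_seqD[OF T, of n] by auto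
  ultimately show "\<bar>window_sum h s n\<bar> = (1 + discord (drops h) T n) / 2" "\<bar>window_sum h s n\<bar> \<le> 1"
    by (auto simp: window_sum_primitive[OF assms] abs_mult)
qed

lemma limsup_eq_attained:
  fixes f :: "nat \<Rightarrow> real"
  assumes "\<forall>\<^sub>F n in sequentially. f n \<le> M" and "\<exists>\<^sub>F n in sequentially. f n = M"
  shows "limsup (\<lambda>n. ereal (f n)) = ereal M"
proof (rule antisym)
  show "limsup (\<lambda>n. ereal (f n)) \<le> ereal M"
    by (rule Limsup_bounded) (use assms(1) in simp)
  show "ereal M \<le> limsup (\<lambda>n. ereal (f n))"
  proof (rule ccontr)
    assume "\<not> ereal M \<le> limsup (\<lambda>n. ereal (f n))"
    then have "\<forall>\<^sub>F n in sequentially. ereal (f n) < ereal M" by (intro Limsup_lessD) simp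
    then have "\<forall>\<^sub>F n in sequentially. \<not> f n = M" by (rule eventually_mono) simp
    then show False using assms(2) by (simp add: frequently_def)
  qed
qed

definition threshold :: "(nat \<Rightarrow> real) \<Rightarrow> real" where
  "threshold h = (1 + discord (drops h) thue_morse 0) / 2"

definition threshold_approx :: "(nat \<Rightarrow> real) \<Rightarrow> nat \<Rightarrow> real" where
  "threshold_approx h k = (1 + discord (drops h) (tm_approx k) 0) / 2"

text \<open>
  The discord of an approximant is largest at \<open>0\<close>, and by periodicity this maximum recurs.
\<close>

lemma limsup_window_sum_periodic:
  assumes h: "halving h" and T: "sign_seq T" and s: "\<And>n. of_int (s n) = (T n - T (Suc n)) / 2"
    and per: "\<And>n. T (N + n) = T N * tm_approx k n"
  shows "limsup (\<lambda>n. ereal \<bar>window_sum h s n\<bar>) = ereal (threshold_approx h k)"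
proof (rule limsup_eq_attained)
  let ?w = "drops h"
  have TN: "T N * T N = 1" using sign_seqD[OF T, of N] by auto
  have per': "T (Suc (N + n)) = T N * tm_approx k (Suc n)" for n using per[of "Suc n"] by simp
  have "discord ?w T (N + n) = discord ?w (tm_approx k) n" for n
  proof -
    have "summable (\<lambda>m. ?w m * tm_approx k (Suc n + m))"
      using summable_weighted_signs[OF drops_superdecreasing[OF h] tm_approx_sign, of 0 k "Suc n"] by simp
    from suminf_mult[OF this, of "T N"]
    have "(\<Sum>m. ?w m * T (Suc (N + n) + m)) = T N * (\<Sum>m. ?w m * tm_approx k (Suc n + m))"
      using per'[of "n + _"] by (simp add: algebra_simps)
    then show ?thesis using TN
      unfolding discord_def per by (simp add: mult.assoc mult.left_commute[of _ "T N" "T N"])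
  qed
  then have y: "\<bar>window_sum h s (N + n)\<bar> = (1 + discord ?w (tm_approx k) n) / 2" for n
    using abs_window_sum_primitive(1)[OF h T s] by simp
  have "\<bar>window_sum h s n\<bar> \<le> threshold_approx h k" if "n \<ge> N" for n
    using y[of "n - N"] that discord_tm_approx_max[OF drops_superdecreasing[OF h], of k "n - N"]
    by (simp add: threshold_approx_def)
  then show "\<forall>\<^sub>F n in sequentially. \<bar>window_sum h s n\<bar> \<le> threshold_approx h k"
    by (auto simp: eventually_sequentially)
  have "discord ?w (tm_approx k) (2 ^ Suc k * i) = discord ?w (tm_approx k) 0" for i
  proof -
    have "tm_approx k (2 ^ Suc k * i) = tm_approx k 0"
      and "tm_approx k (Suc (2 ^ Suc k * i) + m) = tm_approx k (Suc 0 + m)" for m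
      using tm_approx_periodic[of k 0 i] tm_approx_periodic[of k "Suc m" i]
      by (simp_all add: add.commute del: power_Suc)
    then show ?thesis by (simp only: discord_def)
  qed
  then have "\<bar>window_sum h s (N + 2 ^ Suc k * i)\<bar> = threshold_approx h k" for i
    using y by (simp add: threshold_approx_def)
  moreover have "N + 2 ^ Suc k * i \<ge> i" for i
    using mult_le_mono1[of 1 "2 ^ Suc k" i] by (intro trans_le_add2) simp
  ultimately show "\<exists>\<^sub>F n in sequentially. \<bar>window_sum h s n\<bar> = threshold_approx h k"
    unfolding frequently_sequentially by blast
qed

text \<open>
  An upper limit below the threshold leaves a margin \<open>2 (threshold h - c)\<close> for the discord of \<open>T\<close>.
  Of the two outcomes of the dichotomy, a constant \<open>T\<close> would make the digits vanish eventually.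
\<close>

lemma low_limsup_window_sum:
  assumes h: "halving h" and b: "\<And>m. \<bar>s m\<bar> \<le> B" and inf: "\<And>n. \<exists>m\<ge>n. s m \<noteq> 0"
    and low: "limsup (\<lambda>n. ereal \<bar>window_sum h s n\<bar>) < ereal (threshold h)"
  shows "\<exists>k. limsup (\<lambda>n. ereal \<bar>window_sum h s n\<bar>) = ereal (threshold_approx h k)"
proof -
  note w = drops_superdecreasing[OF h]
  obtain c where c: "limsup (\<lambda>n. ereal \<bar>window_sum h s n\<bar>) < ereal c" "c < threshold h"
    using ereal_dense2[OF low] by auto
  have evc: "\<forall>\<^sub>F n in sequentially. \<bar>window_sum h s n\<bar> < c"
    using Limsup_lessD[OF c(1)] by simp
  have th1: "threshold h \<le> 1"
    using discord_bound[OF w thue_morse_sign, of 0] sums_unique[OF sums_drops[OF h, of 0]] h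
    by (simp add: halving_def threshold_def)
  have "\<forall>\<^sub>F n in sequentially. \<bar>window_sum h s n\<bar> < 1"
    by (rule eventually_mono[OF evc]) (use c(2) th1 in linarith)
  from eventually_conj[OF eventually_abs_le_1[OF h b this] evc]
  obtain N where N: "\<And>n. n \<ge> N \<Longrightarrow> \<bar>s n\<bar> \<le> 1" "\<And>n. n \<ge> N \<Longrightarrow> \<bar>window_sum h s n\<bar> < c"
    unfolding eventually_sequentially by blast
  define s' where "s' n = s (N + n)" for n
  have ws: "window_sum h s' n = window_sum h s (n + N)" for n
    by (simp add: window_sum_def s'_def algebra_simps)
  have b': "\<bar>s' m\<bar> \<le> 1" for m using N(1) by (simp add: s'_def)
  have inf': "\<exists>m\<ge>n. s' m \<noteq> 0" for n
  proof -
    obtain m where "m \<ge> N + n" "s m \<noteq> 0" using inf by blast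
    then show ?thesis by (intro exI[of _ "m - N"]) (simp add: s'_def)
  qed
  have "s' (n + k) \<noteq> s' n" if "s' n \<noteq> 0" "0 < k" "\<And>i. 0 < i \<Longrightarrow> i < k \<Longrightarrow> s' (n + i) = 0" for n k
    using equal_neighbours_large[OF h b' that] N(2)[OF le_add2, of n] ws[of n] c(2) th1 by auto
  from alternating_primitive[OF b' inf' this]
  obtain T where T: "sign_seq T" and sT: "\<And>n. of_int (s' n) = (T n - T (Suc n)) / 2" by blast
  have "discord (drops h) T n \<le> discord (drops h) thue_morse 0 - 2 * (threshold h - c)" for n
  proof -
    have "(1 + discord (drops h) T n) / 2 < c"
      using abs_window_sum_primitive(1)[OF h T sT, of n] N(2)[OF le_add2, of n] by (simp add: ws)
    then show ?thesis unfolding threshold_def by argo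
  qed
  then have "\<forall>\<^sub>F n in sequentially. discord (drops h) T n \<le> discord (drops h) thue_morse 0 - 2 * (threshold h - c)"
    by simp
  moreover have "0 < 2 * (threshold h - c)" using c(2) by simp
  ultimately consider (const) M where "\<And>n. n \<ge> M \<Longrightarrow> T n = T M"
    | (per) M k where "\<And>n. T (M + n) = T M * tm_approx k n"
    using low_discord_dichotomy[OF w T] by metis
  then show ?thesis
  proof cases
    case const
    obtain m where "m \<ge> M" "s' m \<noteq> 0" using inf' by blast
    then show ?thesis using sT[of m] const[of m] const[of "Suc m"] by simp
  next
    case per
    have "limsup (\<lambda>n. ereal \<bar>window_sum h s' n\<bar>) = ereal (threshold_approx h k)"
      by (rule limsup_window_sum_periodic[OF h T sT per])
    then have "limsup (\<lambda>n. ereal \<bar>window_sum h s n\<bar>) = ereal (threshold_approx h k)"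
      using limsup_shift_k[of "\<lambda>n. ereal \<bar>window_sum h s n\<bar>" N] by (simp add: ws)
    then show ?thesis by blast
  qed
qed

lemma threshold_approx_props:
  assumes h: "halving h"
  shows "0 < threshold_approx h k" "threshold_approx h k < threshold h"
    and "threshold_approx h \<longlonglongrightarrow> threshold h"
proof -
  note w = drops_superdecreasing[OF h]
  show "0 < threshold_approx h k"
    using discord_nonneg[OF w tm_approx_sign, of k 0] tm_approx_start[of k]
    by (simp add: threshold_approx_def)
  show "threshold_approx h k < threshold h"
    using discord_tm_gap(1)[OF w, of k] by (simp add: threshold_approx_def threshold_def)
  have "(\<lambda>k. suminf (drops h) * (1/2) ^ k) \<longlonglongrightarrow> suminf (drops h) * 0"
    by (intro tendsto_intros LIMSEQ_power_zero) simp
  then have z: "(\<lambda>k. suminf (drops h) * (1/2) ^ k) \<longlonglongrightarrow> 0" by simp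
  have "\<bar>threshold_approx h k - threshold h\<bar> \<le> suminf (drops h) * (1/2) ^ k" for k
    using discord_tm_gap[OF w, of k] by (simp add: threshold_approx_def threshold_def field_simps)
  then have "(\<lambda>k. threshold_approx h k - threshold h) \<longlonglongrightarrow> 0"
    by (intro Lim_null_comparison[OF _ z]) simp
  then show "threshold_approx h \<longlonglongrightarrow> threshold h" by (rule LIM_zero_cancel)
qed

section \<open>The generating series of the approximants\<close>

lemma sums_from_pairs:
  fixes f :: "nat \<Rightarrow> 'a :: real_normed_vector"
  assumes "summable f" "(\<lambda>j. f (2 * j) + f (2 * j + 1)) sums s"
  shows "f sums s"
  using summable_sums[OF assms(1)] sums_pairs sums_unique2[OF assms(2)] by metis

lemma one_plus_power_nonzero:
  fixes X :: complex
  assumes "norm X < 1" "n > 0"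
  shows "1 + X ^ n \<noteq> 0"
proof
  assume "1 + X ^ n = 0"
  then have "norm (X ^ n) = 1" by (metis add_eq_0_iff norm_minus_cancel norm_one)
  then show False using assms power_less_one_iff[of "norm X" n] by (simp add: norm_power)
qed

text \<open>
  A substitution turns the series \<open>G(X)\<close> of a sign sequence into \<open>(1 - X) G(X\<^sup>2)\<close>, and the alternating
  sequence has the series \<open>1 / (1 + X)\<close>.
\<close>

lemma tm_approx_series:
  fixes X :: complex
  assumes "norm X < 1"
  shows "(\<lambda>m. of_real (tm_approx k m) * X ^ m) sums ((\<Prod>m<k. 1 - X ^ (2 ^ m)) / (1 + X ^ (2 ^ k)))"
  using assms
proof (induction k arbitrary: X)
  case 0
  have "(\<lambda>m. (- X) ^ m) sums (1 / (1 - (- X)))" by (rule geometric_sums) (use 0 in simp)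
  then show ?case by (simp add: power_minus[of X])
next
  case (Suc k)
  have "norm (X\<^sup>2) < 1" using Suc.prems by (simp add: norm_power power_less_one_iff abs_square_less_1)
  from sums_mult[OF Suc.IH[OF this], of "1 - X"]
  have *: "(\<lambda>j. (1 - X) * (of_real (tm_approx k j) * (X\<^sup>2) ^ j))
      sums ((1 - X) * ((\<Prod>m<k. 1 - (X\<^sup>2) ^ (2 ^ m)) / (1 + (X\<^sup>2) ^ (2 ^ k))))" .
  have "(1 - X) * (of_real (tm_approx k j) * (X\<^sup>2) ^ j)
      = of_real (tm_approx (Suc k) (2 * j)) * X ^ (2 * j)
          + of_real (tm_approx (Suc k) (2 * j + 1)) * X ^ (2 * j + 1)" for j
  proof -
    have "X ^ (2 * j) = (X\<^sup>2) ^ j" "X ^ (2 * j + 1) = X * (X\<^sup>2) ^ j" by (simp_all add: power_mult)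
    moreover have "tm_approx (Suc k) (2 * j) = tm_approx k j" "tm_approx (Suc k) (2 * j + 1) = - tm_approx k j"
      using tm_approx_doubles[of k] by (simp_all add: doubles_def)
    ultimately show ?thesis by (simp only: left_diff_distrib mult_1 of_real_minus) simp
  qed
  with * have "(\<lambda>j. of_real (tm_approx (Suc k) (2 * j)) * X ^ (2 * j)
            + of_real (tm_approx (Suc k) (2 * j + 1)) * X ^ (2 * j + 1))
      sums ((1 - X) * ((\<Prod>m<k. 1 - (X\<^sup>2) ^ (2 ^ m)) / (1 + (X\<^sup>2) ^ (2 ^ k))))"
    by simp
  also have "(1 - X) * ((\<Prod>m<k. 1 - (X\<^sup>2) ^ (2 ^ m)) / (1 + (X\<^sup>2) ^ (2 ^ k)))
      = (\<Prod>m<Suc k. 1 - X ^ (2 ^ m)) / (1 + X ^ (2 ^ Suc k))"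
    by (simp add: prod.lessThan_Suc_shift power_mult del: prod.lessThan_Suc)
  finally show ?case
  proof (rule sums_from_pairs[rotated])
    show "summable (\<lambda>m. of_real (tm_approx (Suc k) m) * X ^ m)"
    proof (rule summable_comparison_test')
      show "summable (\<lambda>m. norm X ^ m)" using Suc.prems by (simp add: summable_geometric)
      show "norm (of_real (tm_approx (Suc k) m) * X ^ m) \<le> norm X ^ m" for m
        using sign_seqD[OF tm_approx_sign, of "Suc k" m]
        by (auto simp: norm_mult norm_power simp del: tm_approx.simps)
    qed
  qed
qed

definition tm_digit :: "nat \<Rightarrow> nat \<Rightarrow> int" where
  "tm_digit k n = \<lfloor>(tm_approx k n - tm_approx k (Suc n)) / 2\<rfloor>"

lemma tm_digit_eq: "of_int (tm_digit k n) = (tm_approx k n - tm_approx k (Suc n)) / 2"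
  using sign_seqD[OF tm_approx_sign, of k n] sign_seqD[OF tm_approx_sign, of k "Suc n"]
  by (auto simp: tm_digit_def)

lemma tm_digit_bound: "\<bar>tm_digit k n\<bar> \<le> 1"
proof -
  have "\<bar>real_of_int (tm_digit k n)\<bar> \<le> 1"
    using sign_seqD[OF tm_approx_sign, of k n] sign_seqD[OF tm_approx_sign, of k "Suc n"]
    by (auto simp: tm_digit_eq)
  then show ?thesis by linarith
qed

text \<open>
  If \<open>G\<close> is the series of the signs, their halved differences have the series \<open>(1 - (1 - X) G) / (2 X)\<close>.
\<close>

lemma E_trunc_series:
  assumes "X \<noteq> 0" "norm X < 1"
  shows "(\<lambda>m. of_int (tm_digit k m) * X ^ m) sums E_trunc k X"
proof -
  define G where "G = (\<Prod>m<k. 1 - X ^ (2 ^ m)) / (1 + X ^ (2 ^ k))"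
  have G: "(\<lambda>m. of_real (tm_approx k m) * X ^ m) sums G"
    unfolding G_def by (rule tm_approx_series[OF assms(2)])
  have "(\<lambda>m. of_real (tm_approx k (Suc m)) * X ^ Suc m) sums (G - 1)"
    using G tm_approx_start(1)[of k] by (subst sums_Suc_iff) simp
  from sums_divide[OF this, of X]
  have "(\<lambda>m. of_real (tm_approx k (Suc m)) * X ^ m) sums ((G - 1) / X)"
    using assms(1) by simp
  from sums_divide[OF sums_diff[OF G this], of 2]
  have S: "(\<lambda>m. of_real (of_int (tm_digit k m)) * X ^ m) sums ((G - (G - 1) / X) / 2)"
    unfolding tm_digit_eq by (simp add: algebra_simps diff_divide_distrib)
  have frac: "(Q / D - (Q / D - 1) / X) / 2 = (D - (1 - X) * Q) / (2 * X * D)" if "D \<noteq> 0" for Q D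
    using assms(1) that by (simp add: field_simps)
  have "(G - (G - 1) / X) / 2 = E_trunc k X"
    unfolding G_def E_trunc_def
    by (rule frac[OF one_plus_power_nonzero[OF assms(2)]]) simp
  with S show ?thesis by simp
qed

lemma summable_power_two_power:
  fixes X :: complex
  assumes "norm X < 1"
  shows "summable (\<lambda>m. norm (X ^ (2 ^ m)))"
proof (rule summable_comparison_test')
  show "summable (\<lambda>m. norm X ^ m)" using assms by (simp add: summable_geometric)
  show "norm (norm (X ^ (2 ^ m))) \<le> norm X ^ m" for m
    using assms by (simp add: norm_power) (intro power_decreasing, auto intro: less_imp_le)
qed

lemma E_trunc_tendsto:
  assumes "X \<noteq> 0" "norm X < 1"
  shows "(\<lambda>k. E_trunc k X) \<longlonglongrightarrow> E_fun X"
proof -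
  have "abs_convergent_prod (\<lambda>m. 1 - X ^ (2 ^ m))"
    unfolding abs_convergent_prod_conv_summable using summable_power_two_power[OF assms(2)] by simp
  then have "(\<lambda>k. \<Prod>m\<le>k. 1 - X ^ (2 ^ m)) \<longlonglongrightarrow> (\<Prod>m. 1 - X ^ (2 ^ m))"
    by (intro convergent_prod_LIMSEQ abs_convergent_prod_imp_convergent_prod)
  then have P: "(\<lambda>k. \<Prod>m<k. 1 - X ^ (2 ^ m)) \<longlonglongrightarrow> (\<Prod>m. 1 - X ^ (2 ^ m))"
    using LIMSEQ_lessThan_iff_atMost[of "\<lambda>A. \<Prod>m\<in>A. 1 - X ^ (2 ^ m)"] by simp
  have Z: "(\<lambda>k. X ^ (2 ^ k)) \<longlonglongrightarrow> 0"
    using summable_LIMSEQ_zero[OF summable_power_two_power[OF assms(2)]] by (simp add: tendsto_norm_zero_iff)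
  have "(\<lambda>k. E_trunc k X) \<longlonglongrightarrow>
      (1 + 0 - (1 - X) * (\<Prod>m. 1 - X ^ (2 ^ m))) / (2 * X * (1 + 0))"
    unfolding E_trunc_def by (intro tendsto_intros P Z) (use assms(1) in simp)
  then show ?thesis by (simp add: E_fun_def)
qed

section \<open>Partial fractions, complete homogeneous polynomials and linear recurrences\<close>

text \<open>
  The formal series of \<open>1 / (1 - b X)\<close>.
\<close>

definition geom :: "'a :: field \<Rightarrow> 'a fps" where
  "geom b = Abs_fps (\<lambda>n. b ^ n)"

lemma geom_inverse: "fps_of_poly [:1, - b:] * geom b = 1"
proof (rule fps_ext)
  fix n
  have "fps_of_poly [:1, - b:] = 1 - fps_const b * fps_X"
    by (rule fps_ext) (auto simp: coeff_pCons split: nat.split)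
  then have "fps_of_poly [:1, - b:] * geom b = geom b - fps_const b * (fps_X * geom b)"
    by (simp only: left_diff_distrib mult_1 mult.assoc)
  then show "fps_nth (fps_of_poly [:1, - b:] * geom b) n = fps_nth 1 n"
    by (cases n) (simp_all add: geom_def)
qed

text \<open>
  Lagrange interpolation: both sides of \<open>N = \<Sum> c\<^sub>i \<Prod>\<^sub>j\<^sub>\<noteq>\<^sub>i (1 - b\<^sub>j X)\<close> have degree less than the number of points
  \<open>1 / b\<^sub>i\<close>, at which they agree. With \<open>N = 1\<close> this describes complete homogeneous polynomials, with
  general \<open>N\<close> the solutions of a linear recurrence.
\<close>

lemma partial_fractions:
  fixes b :: "nat \<Rightarrow> 'a :: field"
  assumes I: "finite I" and inj: "inj_on b I" and nz: "\<And>i. i \<in> I \<Longrightarrow> b i \<noteq> 0"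
    and N: "degree N < card I"
  shows "fps_of_poly N * (\<Prod>i\<in>I. geom (b i)) =
    (\<Sum>i\<in>I. fps_const (poly N (inverse (b i)) * (\<Prod>j\<in>I - {i}. b i / (b i - b j))) * geom (b i))"
proof -
  define c where "c i = poly N (inverse (b i)) * (\<Prod>j\<in>I - {i}. b i / (b i - b j))" for i
  define L where "L i = (\<Prod>j\<in>I - {i}. [:1, - b j:])" for i
  have NL: "N = (\<Sum>i\<in>I. smult (c i) (L i))"
  proof (rule poly_eqI_degree)
    have "inj_on (\<lambda>i. inverse (b i)) I" using inj by (auto simp: inj_on_def)
    then have card: "card ((\<lambda>i. inverse (b i)) ` I) = card I" by (rule card_image)
    then show "degree N < card ((\<lambda>i. inverse (b i)) ` I)" using N by simp
    have "degree (L i) \<le> card I - 1" if "i \<in> I" for i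
    proof -
      have "degree (L i) \<le> (\<Sum>j\<in>I - {i}. degree [:1, - b j:])"
        unfolding L_def by (rule order_trans[OF degree_prod_sum_le]) (use I in auto)
      also have "\<dots> \<le> (\<Sum>j\<in>I - {i}. 1)" by (rule sum_mono) simp
      finally show ?thesis using that I by simp
    qed
    then have "degree (\<Sum>i\<in>I. smult (c i) (L i)) \<le> card I - 1"
      by (intro degree_sum_le[OF I] order_trans[OF degree_smult_le])
    then show "degree (\<Sum>i\<in>I. smult (c i) (L i)) < card ((\<lambda>i. inverse (b i)) ` I)"
      using card N by simp
    fix x assume "x \<in> (\<lambda>i. inverse (b i)) ` I"
    then obtain k where k: "k \<in> I" "x = inverse (b k)" by auto
    have other: "poly (L i) x = 0" if "i \<in> I" "i \<noteq> k" for i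
    proof -
      have "k \<in> I - {i}" "1 - b k * x = 0" using that k nz[of k] by auto
      then show ?thesis using I by (auto simp: L_def poly_prod mult.commute)
    qed
    have "(\<Prod>j\<in>I - {k}. b k / (b k - b j)) * (\<Prod>j\<in>I - {k}. 1 - b j / b k) = (\<Prod>j\<in>I - {k}. 1)"
      unfolding prod.distrib[symmetric]
    proof (rule prod.cong[OF refl])
      fix j assume "j \<in> I - {k}"
      then have "b k \<noteq> b j" using inj k by (auto dest: inj_onD)
      then show "b k / (b k - b j) * (1 - b j / b k) = 1" using nz[OF k(1)] by (simp add: field_simps)
    qed
    then have self: "c k * poly (L k) x = poly N x"
      by (simp add: c_def L_def poly_prod k(2) divide_inverse mult.commute)
    have "poly (\<Sum>i\<in>I. smult (c i) (L i)) x = (\<Sum>i\<in>I. c i * poly (L i) x)"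
      by (simp add: poly_sum)
    also have "\<dots> = c k * poly (L k) x"
      using I k(1) by (subst sum.remove[of _ k]) (auto simp: other intro!: sum.neutral)
    finally show "poly N x = poly (\<Sum>i\<in>I. smult (c i) (L i)) x" using self by simp
  qed
  have "fps_of_poly (L i) * (\<Prod>i\<in>I. geom (b i)) = geom (b i)" if "i \<in> I" for i
  proof -
    have "fps_of_poly (L i) * (\<Prod>j\<in>I - {i}. geom (b j)) = 1"
      by (simp add: L_def fps_of_poly_prod prod.distrib[symmetric] geom_inverse)
    then show ?thesis
      using I that by (subst prod.remove[of _ i]) (auto simp: mult.left_commute)
  qed
  then show ?thesis
    by (subst NL) (auto simp: fps_of_poly_sum fps_of_poly_smult sum_distrib_right c_def mult.assoc intro!: sum.cong)
qed

lemma finite_exponents: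
  "finite {e. e \<in> {1..r::nat} \<rightarrow>\<^sub>E (UNIV :: nat set) \<and> (\<Sum>j=1..r. e j) = m}"
proof (rule finite_subset)
  show "{e. e \<in> {1..r} \<rightarrow>\<^sub>E (UNIV :: nat set) \<and> (\<Sum>j=1..r. e j) = m} \<subseteq> {1..r} \<rightarrow>\<^sub>E {..m}"
  proof
    fix e assume e: "e \<in> {e. e \<in> {1..r} \<rightarrow>\<^sub>E (UNIV :: nat set) \<and> (\<Sum>j=1..r. e j) = m}"
    then have "e i \<le> m" if "i \<in> {1..r}" for i
      using member_le_sum[OF that, of e] e by simp
    with e show "e \<in> {1..r} \<rightarrow>\<^sub>E {..m}" by (auto simp: PiE_iff)
  qed
  show "finite ({1..r} \<rightarrow>\<^sub>E {..m})" by (intro finite_PiE) auto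
qed

text \<open>
  Sort the exponent vectors by the exponent \<open>m - k\<close> of the last variable.
\<close>

lemma complete_hom_Suc:
  "complete_hom (Suc r) m X = (\<Sum>k=0..m. complete_hom r k X * X (Suc r) ^ (m - k))"
proof -
  let ?S = "\<lambda>r m. {e. e \<in> {1..r} \<rightarrow>\<^sub>E (UNIV :: nat set) \<and> (\<Sum>j=1..r. e j) = m}"
  have bij: "bij_betw (\<lambda>(k, e). e(Suc r := m - k)) (Sigma {0..m} (?S r)) (?S (Suc r) m)"
  proof (rule bij_betwI[where g = "\<lambda>e. (m - e (Suc r), e(Suc r := undefined))"])
    show "(\<lambda>(k, e). e(Suc r := m - k)) \<in> Sigma {0..m} (?S r) \<rightarrow> ?S (Suc r) m"
      by (auto simp: PiE_iff extensional_def)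
    show "(\<lambda>e. (m - e (Suc r), e(Suc r := undefined))) \<in> ?S (Suc r) m \<rightarrow> Sigma {0..m} (?S r)"
      by (auto simp: PiE_iff extensional_def)
    fix x assume "x \<in> Sigma {0..m} (?S r)"
    then show "(\<lambda>e. (m - e (Suc r), e(Suc r := undefined))) (case x of (k, e) \<Rightarrow> e(Suc r := m - k)) = x"
      by (auto simp: PiE_iff extensional_def)
  next
    fix e assume "e \<in> ?S (Suc r) m"
    then show "(case (m - e (Suc r), e(Suc r := undefined)) of (k, e) \<Rightarrow> e(Suc r := m - k)) = e"
      by (auto simp: PiE_iff)
  qed
  have "complete_hom (Suc r) m X
      = (\<Sum>(k, e)\<in>Sigma {0..m} (?S r). \<Prod>j=1..Suc r. X j ^ (e(Suc r := m - k)) j)"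
    unfolding complete_hom_def
    by (subst sum.reindex_bij_betw[OF bij, symmetric]) (simp add: case_prod_unfold)
  also have "\<dots> = (\<Sum>k=0..m. \<Sum>e\<in>?S r k. \<Prod>j=1..Suc r. X j ^ (e(Suc r := m - k)) j)"
    by (rule sum.Sigma[symmetric]) (use finite_exponents in auto)
  also have "\<dots> = (\<Sum>k=0..m. complete_hom r k X * X (Suc r) ^ (m - k))"
    unfolding complete_hom_def sum_distrib_right by (intro sum.cong refl) simp
  finally show ?thesis .
qed

lemma complete_hom_generating:
  "Abs_fps (\<lambda>m. complete_hom r m X) = (\<Prod>i=1..r. geom (X i))"
proof (induction r)
  case 0
  have "complete_hom 0 m X = (if m = 0 then 1 else 0)" for m
  proof -
    have "{e. e \<in> {1..0::nat} \<rightarrow>\<^sub>E (UNIV :: nat set) \<and> (\<Sum>j=1..0. e j) = m}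
        = (if m = 0 then {\<lambda>_. undefined} else {})" by auto
    then show ?thesis unfolding complete_hom_def by simp
  qed
  then show ?case by (simp add: fps_eq_iff)
next
  case (Suc r)
  have "Abs_fps (\<lambda>m. complete_hom (Suc r) m X) = Abs_fps (\<lambda>m. complete_hom r m X) * geom (X (Suc r))"
    by (rule fps_ext) (simp add: complete_hom_Suc fps_mult_nth geom_def)
  then show ?case by (simp add: Suc mult.commute)
qed

lemma complete_hom_partial_fractions:
  assumes "inj_on X {1..d}" "\<And>i. i \<in> {1..d} \<Longrightarrow> X i \<noteq> 0" "d \<ge> 1"
  shows "complete_hom d m X = (\<Sum>i=1..d. (\<Prod>j\<in>{1..d} - {i}. X i / (X i - X j)) * X i ^ m)"
proof -
  have "(\<Prod>i=1..d. geom (X i)) =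
      (\<Sum>i=1..d. fps_const (\<Prod>j\<in>{1..d} - {i}. X i / (X i - X j)) * geom (X i))"
    using partial_fractions[OF _ assms(1,2), of 1] assms(3) by simp
  then have "fps_nth (Abs_fps (\<lambda>m. complete_hom d m X)) m =
      fps_nth (\<Sum>i=1..d. fps_const (\<Prod>j\<in>{1..d} - {i}. X i / (X i - X j)) * geom (X i)) m"
    by (simp add: complete_hom_generating)
  then show ?thesis by (simp add: fps_sum_nth geom_def)
qed

text \<open>
  The recurrence says that the generating function of \<open>x\<close> times the reversed polynomial is a
  polynomial of degree below \<open>d\<close>. Partial fractions then write the generating function as a combination of
  geometric series.
\<close>

lemma recurrence_power_sum:
  fixes \<alpha> :: "nat \<Rightarrow> 'a :: field" and x :: "nat \<Rightarrow> 'a"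
  assumes p: "p = (\<Prod>i=1..d. [:- \<alpha> i, 1:])"
    and inj: "inj_on \<alpha> {1..d}" and nz: "\<And>i. i \<in> {1..d} \<Longrightarrow> \<alpha> i \<noteq> 0" and d: "d \<ge> 1"
    and rec: "\<And>n. (\<Sum>j\<le>d. coeff p j * x (n + j)) = 0"
  shows "\<exists>g. \<forall>n. x n = (\<Sum>i=1..d. g i * \<alpha> i ^ n)"
proof -
  have deg: "degree p = d" unfolding p by (subst degree_prod_eq_sum_degree) auto
  have "reflect_poly p = (\<Prod>i=1..d. [:1, - \<alpha> i:])"
    unfolding p reflect_poly_prod
    by (rule prod.cong[OF refl]) (use nz in \<open>simp add: reflect_poly_pCons\<close>)
  then have Q: "fps_of_poly (reflect_poly p) * (\<Prod>i=1..d. geom (\<alpha> i)) = 1"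
    by (simp add: fps_of_poly_prod prod.distrib[symmetric] geom_inverse)
  define F where "F = fps_of_poly (reflect_poly p) * Abs_fps x"
  have F0: "fps_nth F n = 0" if "n \<ge> d" for n
  proof -
    have "fps_nth F n = (\<Sum>i=0..n. coeff (reflect_poly p) i * x (n - i))"
      by (simp add: F_def fps_mult_nth)
    also have "\<dots> = (\<Sum>i\<le>d. coeff p (d - i) * x (n - i))"
      using that by (intro sum.mono_neutral_cong_right) (auto simp: coeff_reflect_poly deg)
    also have "\<dots> = (\<Sum>j\<le>d. coeff p j * x ((n - d) + j))"
      using that by (intro sum.reindex_bij_witness[where i="\<lambda>j. d - j" and j="\<lambda>j. d - j"]) auto
    finally show ?thesis using rec by simp
  qed
  define N where "N = (\<Sum>k<d. monom (fps_nth F k) k)"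
  have cN: "coeff N n = (if n < d then fps_nth F n else 0)" for n
    by (simp add: N_def coeff_sum if_distrib cong: if_cong)
  have "F = fps_of_poly N" using F0 by (auto simp: fps_eq_iff cN)
  have "degree N < card {1..d}"
  proof -
    have "degree N \<le> d - 1" by (rule degree_le) (use cN in auto)
    then show ?thesis using d by simp
  qed
  have "Abs_fps x = fps_of_poly N * (\<Prod>i=1..d. geom (\<alpha> i))"
  proof -
    have "fps_of_poly N * (\<Prod>i=1..d. geom (\<alpha> i))
        = Abs_fps x * (fps_of_poly (reflect_poly p) * (\<Prod>i=1..d. geom (\<alpha> i)))"
      unfolding \<open>F = fps_of_poly N\<close>[symmetric] F_def by (simp only: mult_ac)
    then show ?thesis by (simp only: Q mult_1_right)
  qed
  also have "\<dots> = (\<Sum>i=1..d. fps_const (poly N (inverse (\<alpha> i)) * (\<Prod>j\<in>{1..d} - {i}. \<alpha> i / (\<alpha> i - \<alpha> j))) * geom (\<alpha> i))"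
    by (rule partial_fractions[OF _ inj nz]) (use \<open>degree N < card {1..d}\<close> in auto)
  finally have "fps_nth (Abs_fps x) n = fps_nth \<dots> n" for n by simp
  then have "x n = (\<Sum>i=1..d. (poly N (inverse (\<alpha> i)) * (\<Prod>j\<in>{1..d} - {i}. \<alpha> i / (\<alpha> i - \<alpha> j))) * \<alpha> i ^ n)" for n
    by (simp add: fps_sum_nth geom_def)
  then show ?thesis
    by (intro exI[of _ "\<lambda>i. poly N (inverse (\<alpha> i)) * (\<Prod>j\<in>{1..d} - {i}. \<alpha> i / (\<alpha> i - \<alpha> j))"] allI)
qed

text \<open>
  Averaging \<open>g\<close> with its image under complex conjugation, which permutes the roots, produces the
  symmetry of \<open>Xi0\<close> and does not change the real part of the power sum.
\<close>

lemma symmetrise: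
  assumes real: "\<forall>i\<in>{1..r1}. \<alpha> i \<in> \<real>"
    and conj: "\<forall>i\<in>{1..r2}. \<alpha> (r1 + r2 + i) = cnj (\<alpha> (r1 + i))"
  shows "\<exists>g'\<in>Xi0 r1 r2. \<forall>n. xseq \<alpha> r1 r2 g' n = Re (\<Sum>i=1..r1+2*r2. g i * \<alpha> i ^ n)"
proof -
  \<comment> \<open>The permutation of the indices that complex conjugation induces on the roots.\<close>
  define \<pi> where "\<pi> i = (if i \<le> r1 then i else if i \<le> r1 + r2 then i + r2 else i - r2)" for i
  define g' where "g' i = (g i + cnj (g (\<pi> i))) / 2" for i
  let ?p = "r1 + 2 * r2"
  have c: "cnj (\<alpha> i) = \<alpha> (\<pi> i)" if i: "i \<in> {1..?p}" for i
  proof -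
    consider "i \<le> r1" | "r1 < i" "i \<le> r1 + r2" | "r1 + r2 < i" by linarith
    then show ?thesis
    proof cases
      case 1
      then have "\<alpha> i \<in> \<real>" using real i by auto
      then show ?thesis using 1 by (simp add: \<pi>_def Reals_cnj_iff)
    next
      case 2
      then have "i - r1 \<in> {1..r2}" by auto
      from bspec[OF conj this] show ?thesis using 2 by (simp add: \<pi>_def add.commute)
    next
      case 3
      then have "i - r1 - r2 \<in> {1..r2}" using i by auto
      from bspec[OF conj this] have "\<alpha> i = cnj (\<alpha> (i - r2))" using 3 by simp
      then show ?thesis using 3 by (simp add: \<pi>_def)
    qed
  qed
  have re: "(\<Sum>i=1..?p. f (\<pi> i)) = (\<Sum>i=1..?p. f i)" for f :: "nat \<Rightarrow> complex"
    by (rule sum.reindex_bij_witness[where i=\<pi> and j=\<pi>]) (auto simp: \<pi>_def)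
  have "xseq \<alpha> r1 r2 g' n = Re (\<Sum>i=1..?p. g i * \<alpha> i ^ n)" for n
  proof -
    have "(\<Sum>i=1..?p. g' i * \<alpha> i ^ n)
        = ((\<Sum>i=1..?p. g i * \<alpha> i ^ n) + (\<Sum>i=1..?p. cnj (g (\<pi> i)) * \<alpha> i ^ n)) / 2"
      by (simp add: g'_def sum.distrib[symmetric] sum_divide_distrib algebra_simps)
    also have "(\<Sum>i=1..?p. cnj (g (\<pi> i)) * \<alpha> i ^ n) = (\<Sum>i=1..?p. cnj (g (\<pi> i) * \<alpha> (\<pi> i) ^ n))"
      by (rule sum.cong[OF refl]) (simp add: c[symmetric])
    also have "\<dots> = cnj (\<Sum>i=1..?p. g i * \<alpha> i ^ n)"
      using re[of "\<lambda>i. cnj (g i * \<alpha> i ^ n)"] by simp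
    finally have half: "(\<Sum>i=1..?p. g' i * \<alpha> i ^ n)
        = ((\<Sum>i=1..?p. g i * \<alpha> i ^ n) + cnj (\<Sum>i=1..?p. g i * \<alpha> i ^ n)) / 2" .
    have "Re ((z + cnj z) / 2) = Re z" for z by simp
    then show ?thesis unfolding xseq_def half .
  qed
  moreover have "g' \<in> Xi0 r1 r2"
    unfolding Xi0_def
  proof (intro CollectI conjI ballI)
    fix i assume "i \<in> {1..r1}"
    then show "g' i \<in> \<real>" by (simp add: g'_def \<pi>_def Reals_cnj_iff add.commute)
  next
    fix i assume "i \<in> {1..r2}"
    then show "cnj (g' (r1 + i)) = g' (r1 + r2 + i)"
      by (auto simp: g'_def \<pi>_def add.commute add.left_commute)
  qed
  ultimately show ?thesis by blast
qed

section \<open>Inverting a monic recurrence\<close>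

text \<open>
  At \<open>\<bar>e\<bar> = 1/2\<close> the rounding may choose either neighbour, but the distance is the same.
\<close>

lemma dist_nearest_int_eq:
  assumes "\<bar>e\<bar> \<le> 1/2"
  shows "dist_nearest_int (of_int u + e) = \<bar>e\<bar>"
proof (cases "round (of_int u + e) = u")
  case True
  then show ?thesis by (simp add: dist_nearest_int_def)
next
  case False
  let ?r = "round (of_int u + e)"
  have "\<bar>of_int u + e - of_int ?r\<bar> \<le> \<bar>e\<bar>" using round_diff_minimal[of "of_int u + e" u] by simp
  moreover have "\<bar>real_of_int (?r - u)\<bar> \<ge> 1" using False by linarith
  ultimately show ?thesis using assms by (simp add: dist_nearest_int_def)
qed

text \<open>
  Integer solution with zero initial values of the inhomogeneous recurrence
  \<open>a\<^sub>0 u\<^sub>n + \<dots> + a\<^sub>d u\<^sub>n\<^sub>+\<^sub>d = s\<^sub>n\<close> when \<open>a\<^sub>d = 1\<close>.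
\<close>

fun monic_recurrence :: "nat \<Rightarrow> (nat \<Rightarrow> int) \<Rightarrow> (nat \<Rightarrow> int) \<Rightarrow> nat \<Rightarrow> int" where
  "monic_recurrence d a s n =
     (if n < d then 0 else s (n - d) - (\<Sum>j\<in>{..<d}. a j * monic_recurrence d a s (n - d + j)))"
declare monic_recurrence.simps [simp del]

lemma monic_recurrence_solves:
  assumes "a d = 1"
  shows "(\<Sum>j\<le>d. a j * monic_recurrence d a s (n + j)) = s n"
  using monic_recurrence.simps[of d a s "n + d"] assms by (simp flip: lessThan_Suc_atMost)

text \<open>
  The shift operator \<open>S\<close> acts on bounded sequences, where the power series \<open>\<Sum> h\<^sub>m S\<^sup>m\<close> converges and is,
  up to the factor \<open>c\<close>, inverse to the polynomial \<open>\<Sum> a\<^sub>j S\<^sup>j\<close>. The two statements are the two orders of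
  composition: the first recovers \<open>s\<close> from its window sums, the second recovers the rounding errors from \<open>s\<close>.
\<close>

lemma inverse_convolution:
  fixes a h v :: "nat \<Rightarrow> real"
  assumes h: "summable h" "\<And>m. 0 \<le> h m" and v: "\<And>m. \<bar>v m\<bar> \<le> B"
    and inv: "\<And>n. (\<Sum>j\<le>n. a j * h (n - j)) = (if n = 0 then c else 0)"
    and a: "\<And>j. j > d \<Longrightarrow> a j = 0"
  shows "(\<Sum>j\<le>d. a j * (\<Sum>m. h m * v (n + j + m))) = c * v n"
    and "(\<Sum>m. h m * (\<Sum>j\<le>d. a j * v (n + m + j))) = c * v n"
proof -
  have s: "summable (\<lambda>m. h m * v (k + m))" for k
    by (rule summable_weighted_bounded[OF h v])
  have shifted: "(\<lambda>N. (if j \<le> N then h (N - j) else 0) * v (n + N)) sums (\<Sum>m. h m * v (n + j + m))" for j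
  proof -
    have "(\<lambda>N. (if j \<le> N + j then h (N + j - j) else 0) * v (n + (N + j))) sums (\<Sum>m. h m * v (n + j + m))"
      using summable_sums[OF s[of "n + j"]] by (simp add: add.assoc add.commute add.left_commute)
    then show ?thesis
      using sums_iff_shift[where f="\<lambda>N. (if j \<le> N then h (N - j) else 0) * v (n + N)" and n=j]
      by simp
  qed
  have "(\<lambda>N. \<Sum>j\<le>d. a j * ((if j \<le> N then h (N - j) else 0) * v (n + N)))
      sums (\<Sum>j\<le>d. a j * (\<Sum>m. h m * v (n + j + m)))"
    by (intro sums_sum sums_mult shifted)
  moreover have "(\<Sum>j\<le>d. a j * ((if j \<le> N then h (N - j) else 0) * v (n + N)))
      = (if N = 0 then c * v n else 0)" for N
  proof -
    have "(\<Sum>j\<le>d. a j * ((if j \<le> N then h (N - j) else 0) * v (n + N)))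
        = (\<Sum>j\<le>d. a j * (if j \<le> N then h (N - j) else 0)) * v (n + N)"
      by (simp add: sum_distrib_right mult.assoc)
    also have "(\<Sum>j\<le>d. a j * (if j \<le> N then h (N - j) else 0)) = (\<Sum>j\<in>{..d} \<inter> {..N}. a j * h (N - j))"
      by (rule sum.mono_neutral_cong_right) auto
    also have "\<dots> = (\<Sum>j\<le>N. a j * h (N - j))"
      by (rule sum.mono_neutral_left) (auto simp: a)
    finally show ?thesis by (simp add: inv)
  qed
  ultimately have "(\<lambda>N. if N = 0 then c * v n else 0) sums (\<Sum>j\<le>d. a j * (\<Sum>m. h m * v (n + j + m)))"
    by simp
  from sums_unique2[OF this sums_single[of 0 "\<lambda>_. c * v n"]]
  show 1: "(\<Sum>j\<le>d. a j * (\<Sum>m. h m * v (n + j + m))) = c * v n" .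
  have "(\<lambda>m. \<Sum>j\<le>d. a j * (h m * v (n + j + m))) sums (\<Sum>j\<le>d. a j * (\<Sum>m. h m * v (n + j + m)))"
    by (intro sums_sum sums_mult summable_sums s)
  moreover have "(\<Sum>j\<le>d. a j * (h m * v (n + j + m))) = h m * (\<Sum>j\<le>d. a j * v (n + m + j))" for m
    by (simp add: sum_distrib_left mult.left_commute ac_simps)
  ultimately show "(\<Sum>m. h m * (\<Sum>j\<le>d. a j * v (n + m + j))) = c * v n"
    using 1 by (simp add: sums_iff)
qed

text \<open>
  A negative factor exchanges the two alternatives.
\<close>

lemma monotone_chain_scale:
  assumes "c \<noteq> 0" and "monotone_chain u"
  shows "monotone_chain (\<lambda>m. complex_of_real c * u m)"
proof -
  have "2 ^ m * (of_real c * u m) = of_real c * (2 ^ m * u m)" for m by simp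
  then have eq: "monotone_chain (\<lambda>m. of_real c * u m) \<longleftrightarrow>
     (\<forall>m. of_real c * (2 ^ m * u m) \<ge> of_real c * (2 ^ Suc m * u (Suc m)) \<and> of_real c * (2 ^ m * u m) > 0) \<or>
     (\<forall>m. of_real c * (2 ^ m * u m) \<le> of_real c * (2 ^ Suc m * u (Suc m)) \<and> of_real c * (2 ^ m * u m) < 0)"
    unfolding monotone_chain_def by (simp add: mult.left_commute)
  have le: "of_real c * x \<le> of_real c * y \<longleftrightarrow> (if c > 0 then x \<le> y else y \<le> x)" for x y :: complex
    using assms(1) by (auto simp: less_eq_complex_def)
  have lt: "of_real c * x < of_real c * y \<longleftrightarrow> (if c > 0 then x < y else y < x)" for x y :: complex
    using assms(1) by (auto simp: less_complex_def)
  from lt[of 0] lt[of _ 0] show ?thesis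
    unfolding eq le using assms(2)[unfolded monotone_chain_def] by (cases "c > 0") auto
qed

section \<open>The spectrum of a monic expansive polynomial\<close>

locale monic_expansive =
  fixes P :: "int poly" and \<alpha> :: "nat \<Rightarrow> complex" and r1 r2 :: nat
  assumes admissible: "admissible P"
    and enum: "root_enumeration P \<alpha> r1 r2"
    and monic: "lead_coeff P = 1"
    and expansive: "expansive P r1 r2"
begin

definition d :: nat where "d = degree P"

definition X :: "nat \<Rightarrow> complex" where "X i = inverse (\<alpha> i)"

definition hom :: "nat \<Rightarrow> complex" where "hom m = complete_hom d m X"

definition a0 :: int where "a0 = coeff P 0"

lemma factorisation: "complex_poly P = (\<Prod>i=1..d. [:- \<alpha> i, 1:])"
  using enum monic by (simp add: root_enumeration_def d_def)

lemma degree_split: "r1 + 2 * r2 = d"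
  using expansive by (simp add: expansive_def d_def)

lemma d_pos: "d \<ge> 1"
  using admissible by (simp add: admissible_def d_def)

lemma cmod_root: "i \<in> {1..d} \<Longrightarrow> 1 < cmod (\<alpha> i)"
  using enum degree_split by (simp add: root_enumeration_def)

lemma root_nonzero: "i \<in> {1..d} \<Longrightarrow> \<alpha> i \<noteq> 0"
  using cmod_root by fastforce

lemma X_nonzero: "i \<in> {1..d} \<Longrightarrow> X i \<noteq> 0"
  using root_nonzero by (simp add: X_def)

lemma cmod_X: "i \<in> {1..d} \<Longrightarrow> cmod (X i) < 1"
  using cmod_root[of i] by (simp add: X_def norm_inverse inverse_less_1_iff)

text \<open>
  A repeated root would also be a root of the derivative.
\<close>

lemma roots_distinct: "inj_on \<alpha> {1..d}"
proof (rule inj_onI, rule ccontr)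
  fix i j assume ij: "i \<in> {1..d}" "j \<in> {1..d}" "\<alpha> i = \<alpha> j" "i \<noteq> j"
  define q where "q = (\<Prod>i\<in>{1..d} - {i} - {j}. [:- \<alpha> i, 1:])"
  have eq: "complex_poly P = [:- \<alpha> i, 1:] * ([:- \<alpha> j, 1:] * q)"
    unfolding factorisation q_def using ij by (simp add: prod.remove[of _ i] prod.remove[of _ j])
  have "poly (complex_poly P) (\<alpha> i) = 0 \<and> poly (pderiv (complex_poly P)) (\<alpha> i) = 0"
    unfolding eq pderiv_mult poly_add poly_mult using ij(3) by simp
  moreover have "rsquarefree (complex_poly P)" using admissible by (simp add: admissible_def)
  ultimately show False unfolding rsquarefree_roots by blast
qed

lemma X_distinct: "inj_on X {1..d}"
  by (rule inj_onI) (simp add: X_def inj_on_eq_iff[OF roots_distinct])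

lemma coeff_0_eq: "of_int a0 = (\<Prod>i=1..d. - \<alpha> i)"
proof -
  have "of_int a0 = poly (complex_poly P) 0" by (simp add: a0_def poly_0_coeff_0 coeff_map_poly)
  then show ?thesis by (simp add: factorisation poly_prod)
qed

text \<open>
  An integer that is a nonempty product of numbers of modulus greater than \<open>1\<close>. This bound makes the errors
  in \<open>orbit_of_digits\<close> at most \<open>1/2\<close>.
\<close>

lemma abs_a0: "\<bar>a0\<bar> \<ge> 2"
proof -
  have "1 < (\<Prod>i=1..d. cmod (\<alpha> i))"
    by (rule less_1_prod) (use d_pos cmod_root in auto)
  also have "(\<Prod>i=1..d. cmod (\<alpha> i)) = cmod (of_int a0)"
    unfolding coeff_0_eq by (simp add: prod_norm[symmetric])
  finally show ?thesis by simp
qed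

lemma generating_function:
  "fps_of_poly (complex_poly P) * Abs_fps hom = fps_const (of_int a0)"
proof -
  have "[:- \<alpha> i, 1:] = smult (- \<alpha> i) [:1, - X i:]" if "i \<in> {1..d}" for i
    using root_nonzero[OF that] by (simp add: X_def)
  then have "complex_poly P = (\<Prod>i=1..d. smult (- \<alpha> i) [:1, - X i:])"
    unfolding factorisation by (intro prod.cong) auto
  also have "\<dots> = smult (of_int a0) (\<Prod>i=1..d. [:1, - X i:])"
    unfolding coeff_0_eq by (rule prod_smult)
  finally have "fps_of_poly (complex_poly P) * Abs_fps hom
      = fps_const (of_int a0) * (\<Prod>i=1..d. fps_of_poly [:1, - X i:] * geom (X i))"
    by (simp add: hom_def[abs_def] complete_hom_generating fps_of_poly_smult fps_of_poly_prod prod.distrib mult.assoc)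
  then show ?thesis by (simp only: geom_inverse prod.neutral_const mult_1_right)
qed

lemma hom_0: "hom 0 = 1"
proof -
  have "fps_nth (\<Prod>i\<in>I. geom (X i)) 0 = 1" for I
    by (induction I rule: infinite_finite_induct) (simp_all add: geom_def)
  then have "fps_nth (Abs_fps (\<lambda>m. complete_hom d m X)) 0 = 1"
    unfolding complete_hom_generating .
  then show ?thesis by (simp add: hom_def)
qed

lemma hom_convolution:
  "(\<Sum>j\<le>n. of_int (coeff P j) * hom (n - j)) = (if n = 0 then of_int a0 else 0)"
proof -
  have "fps_nth (fps_of_poly (complex_poly P) * Abs_fps hom) n = fps_nth (fps_const (of_int a0)) n"
    by (simp only: generating_function)
  then show ?thesis by (simp add: fps_mult_nth coeff_map_poly atLeast0AtMost)
qed

lemma hom_power_sum: "hom m = (\<Sum>i=1..d. (\<Prod>j\<in>{1..d} - {i}. X i / (X i - X j)) * X i ^ m)"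
  unfolding hom_def by (rule complete_hom_partial_fractions[OF X_distinct X_nonzero d_pos])

text \<open>
  Up to the sign, \<open>\<rho>\<^sub>-\<^sub>m\<close> is the Cauchy integral for the coefficient of \<open>z\<^sup>m\<close> in \<open>1 / P(z)\<close>.
\<close>

lemma rho_eq:
  assumes "1 < r" "\<forall>i\<in>{1..d}. r < cmod (\<alpha> i)"
  shows "rho P r (- int m) = of_real (- 1 / of_int a0) * hom m"
proof -
  let ?p = "complex_poly P"
  have a0: "a0 \<noteq> 0" using abs_a0 by auto
  have nz: "poly ?p z \<noteq> 0" if "cmod z \<le> r" for z
    using assms(2) that unfolding factorisation by (auto simp: poly_prod)
  have inv: "inverse (fps_of_poly ?p) = fps_const (1 / of_int a0) * Abs_fps hom"
  proof (rule fps_inverse_unique)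
    have "fps_of_poly ?p * (fps_const (1 / of_int a0) * Abs_fps hom)
        = fps_const (1 / of_int a0) * (fps_of_poly ?p * Abs_fps hom)" by (simp only: mult_ac)
    then show "fps_of_poly ?p * (fps_const (1 / of_int a0) * Abs_fps hom) = 1"
      unfolding generating_function using a0 by simp
  qed
  have "poly ?p has_fps_expansion fps_of_poly ?p"
  proof -
    have "eval_fps (fps_of_poly ?p) = poly ?p" by (rule ext) simp
    then show ?thesis using eval_fps_has_fps_expansion[of "fps_of_poly ?p"] by simp
  qed
  then have "(\<lambda>z. inverse (poly ?p z)) has_fps_expansion inverse (fps_of_poly ?p)"
    by (rule has_fps_expansion_inverse) (use a0 in \<open>simp add: coeff_map_poly a0_def\<close>)
  from fps_nth_fps_expansion[OF this, of m]
  have deriv: "(deriv ^^ m) (\<lambda>z. inverse (poly ?p z)) 0 / fact m = hom m / of_int a0"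
    unfolding inv by simp
  have "((\<lambda>z. inverse (poly ?p z) / (z - 0) ^ Suc m) has_contour_integral
      (2 * pi * \<i>) / fact m * (deriv ^^ m) (\<lambda>z. inverse (poly ?p z)) 0) (circlepath 0 r)"
  proof (rule Cauchy_has_contour_integral_higher_derivative_circlepath)
    show "continuous_on (cball 0 r) (\<lambda>z. inverse (poly ?p z))"
      by (intro continuous_intros) (use nz in auto)
    show "(\<lambda>z. inverse (poly ?p z)) holomorphic_on ball 0 r"
      by (intro holomorphic_intros) (use nz in auto)
    show "0 \<in> ball 0 r" using assms(1) by simp
  qed
  then have "((\<lambda>z. z powi (- int m - 1) / poly ?p z) has_contour_integral
      (2 * pi * \<i>) / fact m * (deriv ^^ m) (\<lambda>z. inverse (poly ?p z)) 0) (circlepath 0 r)"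
  proof (rule has_contour_integral_eq)
    fix z assume "z \<in> path_image (circlepath 0 r)"
    have "- int m - 1 = - int (Suc m)" by simp
    then have "z powi (- int m - 1) = inverse (z ^ Suc m)"
      by (simp only: power_int_minus power_int_of_nat)
    then show "inverse (poly ?p z) / (z - 0) ^ Suc m = z powi (- int m - 1) / poly ?p z"
      by (simp add: divide_inverse del: power_Suc)
  qed
  then have "contour_integral (circlepath 0 r) (\<lambda>z. z powi (- int m - 1) / poly ?p z)
      = 2 * pi * \<i> * ((deriv ^^ m) (\<lambda>z. inverse (poly ?p z)) 0 / fact m)"
    by (simp add: contour_integral_unique)
  then show ?thesis unfolding rho_def deriv by (simp add: field_simps)
qed

lemma chain_equivalence:
  assumes "1 < r" "\<forall>i\<in>{1..d}. r < cmod (\<alpha> i)"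
  shows "monotone_chain (\<lambda>m. rho P r (- int m)) \<longleftrightarrow> monotone_chain hom"
proof
  have a0: "a0 \<noteq> 0" using abs_a0 by auto
  assume "monotone_chain (\<lambda>m. rho P r (- int m))"
  from monotone_chain_scale[OF _ this, of "- of_int a0"] show "monotone_chain hom"
    using a0 by (simp add: rho_eq[OF assms])
next
  assume "monotone_chain hom"
  from monotone_chain_scale[OF _ this, of "- 1 / of_int a0"] show "monotone_chain (\<lambda>m. rho P r (- int m))"
    unfolding rho_eq[OF assms] using abs_a0 by auto
qed

end

locale monic_expansive_chain = monic_expansive +
  assumes chain: "monotone_chain hom"
begin

definition h :: "nat \<Rightarrow> real" where "h m = Re (hom m)"

text \<open>
  The value \<open>hom 0 = 1\<close> rules out the negative alternative of the chain.
\<close>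

lemma hom_pos: "0 < hom m \<and> 2 * hom (Suc m) \<le> hom m"
proof -
  have *: "\<forall>m. 2 ^ m * hom m \<ge> 2 ^ Suc m * hom (Suc m) \<and> 2 ^ m * hom m > 0"
  proof -
    have "\<not> (\<forall>m. 2 ^ m * hom m \<le> 2 ^ Suc m * hom (Suc m) \<and> 2 ^ m * hom m < 0)"
      using hom_0 by (auto simp: less_complex_def intro!: exI[of _ 0])
    then show ?thesis using chain unfolding monotone_chain_def by blast
  qed
  have two: "(2::complex) ^ k = of_real (2 ^ k)" for k by simp
  from * have "2 ^ m * hom m > 0" "2 ^ m * hom m \<ge> 2 ^ m * (2 * hom (Suc m))"
    by (auto simp: algebra_simps)
  then show ?thesis unfolding two less_eq_complex_def less_complex_def by (auto simp: zero_less_mult_iff)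
qed

lemma hom_real: "hom m = of_real (h m)"
  using hom_pos[of m] by (auto simp: h_def complex_eq_iff less_complex_def)

lemma halving: "halving h"
  unfolding halving_def
proof (intro conjI allI)
  show "h 0 = 1" by (simp add: h_def hom_0)
  show "0 < h m" "2 * h (Suc m) \<le> h m" for m
    using hom_pos[of m] by (auto simp: h_def less_complex_def less_eq_complex_def)
qed

lemma h_summable: "summable h"
  using halving_summable[OF halving, of 0] by simp

lemma h_nonneg: "0 \<le> h m"
  using halving by (simp add: halving_def less_imp_le)

lemma h_convolution:
  "(\<Sum>j\<le>n. of_int (coeff P j) * h (n - j)) = (if n = 0 then of_int a0 else 0)"
proof -
  have "complex_of_real (\<Sum>j\<le>n. of_int (coeff P j) * h (n - j)) = of_real (if n = 0 then of_int a0 else 0)"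
    using hom_convolution[of n] by (simp add: hom_real)
  then show ?thesis unfolding of_real_eq_iff .
qed

lemmas inverse_conv = inverse_convolution[OF h_summable h_nonneg _ h_convolution]

lemma xseq_recurrence: "(\<Sum>j\<le>d. of_int (coeff P j) * xseq \<alpha> r1 r2 g (n + j)) = 0"
proof -
  have root: "(\<Sum>j\<le>d. of_int (coeff P j) * \<alpha> i ^ j) = 0" if "i \<in> {1..d}" for i
  proof -
    have "poly (complex_poly P) (\<alpha> i) = 0"
      unfolding factorisation using that by (auto simp: poly_prod)
    then show ?thesis by (simp add: poly_altdef degree_map_poly coeff_map_poly d_def)
  qed
  have "(\<Sum>j\<le>d. of_int (coeff P j) * (\<Sum>i=1..d. g i * \<alpha> i ^ (n + j)))
      = (\<Sum>i=1..d. g i * \<alpha> i ^ n * (\<Sum>j\<le>d. of_int (coeff P j) * \<alpha> i ^ j))"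
    unfolding sum_distrib_left
    by (subst sum.swap) (simp add: power_add mult_ac)
  also have "\<dots> = 0" by (rule sum.neutral) (simp add: root)
  finally have "Re (\<Sum>j\<le>d. of_int (coeff P j) * (\<Sum>i=1..d. g i * \<alpha> i ^ (n + j))) = 0" by simp
  then show ?thesis by (simp add: xseq_def degree_split)
qed

text \<open>
  The digits are what the recurrence makes of the nearest integers; they are minus what it makes of
  the bounded rounding errors, and so the errors can be recovered from them.
\<close>

lemma digits_of_orbit:
  "\<exists>s B. (\<forall>m. \<bar>s m\<bar> \<le> B) \<and>
     (\<forall>n. \<bar>window_sum h s n\<bar> = \<bar>of_int a0\<bar> * dist_nearest_int (xseq \<alpha> r1 r2 g n))"
proof -
  define x where "x = xseq \<alpha> r1 r2 g"
  define e where "e n = x n - of_int (round (x n))" for n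
  define s where "s n = (\<Sum>j\<le>d. coeff P j * round (x (n + j)))" for n
  have e_bound: "\<bar>e n\<bar> \<le> 1" for n
    using of_int_round_abs_le[of "x n"] by (simp add: e_def abs_minus_commute)
  have s_e: "of_int (s n) = - (\<Sum>j\<le>d. of_int (coeff P j) * e (n + j))" for n
    using xseq_recurrence[of g n] by (simp add: s_def e_def x_def right_diff_distrib sum_subtractf)
  have s_bound: "\<bar>real_of_int (s n)\<bar> \<le> (\<Sum>j\<le>d. \<bar>of_int (coeff P j)\<bar>)" for n
  proof -
    have "\<bar>of_int (coeff P j) * e (n + j)\<bar> \<le> \<bar>of_int (coeff P j)\<bar>" for j
      using mult_left_mono[OF e_bound[of "n + j"], of "\<bar>of_int (coeff P j)\<bar>"] by (simp add: abs_mult)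
    then have "(\<Sum>j\<le>d. \<bar>of_int (coeff P j) * e (n + j)\<bar>) \<le> (\<Sum>j\<le>d. \<bar>of_int (coeff P j)\<bar>)"
      by (intro sum_mono)
    from order_trans[OF sum_abs this] show ?thesis by (simp add: s_e)
  qed
  then have s_bound_int: "\<bar>s n\<bar> \<le> (\<Sum>j\<le>d. \<bar>coeff P j\<bar>)" for n
    by (simp flip: of_int_abs of_int_sum)
  have "window_sum h s n = - (of_int a0 * e n)" for n
  proof -
    have "(\<Sum>m. h m * (\<Sum>j\<le>d. of_int (coeff P j) * e (n + m + j))) = of_int a0 * e n"
      by (rule inverse_conv(2)[OF e_bound]) (simp add: coeff_eq_0 d_def)
    moreover have "summable (\<lambda>m. h m * of_int (s (n + m)))"
      by (rule summable_weighted_bounded(1)[OF h_summable h_nonneg s_bound])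
    from suminf_minus[OF this]
    have "(\<Sum>m. h m * (\<Sum>j\<le>d. of_int (coeff P j) * e (n + m + j))) = - window_sum h s n"
      by (simp add: s_e window_sum_def)
    ultimately show ?thesis by simp
  qed
  then have "\<bar>window_sum h s n\<bar> = \<bar>of_int a0\<bar> * dist_nearest_int (xseq \<alpha> r1 r2 g n)" for n
    by (simp add: abs_mult e_def dist_nearest_int_def x_def)
  with s_bound_int show ?thesis by blast
qed

text \<open>
  The window sums give a bounded solution \<open>e\<close> of the recurrence with right-hand side \<open>-s\<close>. Adding
  an integer solution \<open>u\<close> with right-hand side \<open>s\<close> gives a solution of the homogeneous recurrence, which
  is a power sum of the roots and differs from the integers \<open>u\<close> by errors of modulus at most \<open>1/2\<close>.
\<close>

lemma orbit_of_digits: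
  assumes b: "\<And>m. \<bar>s m\<bar> \<le> B" and small: "\<And>n. \<bar>window_sum h s n\<bar> \<le> 1"
  shows "\<exists>g\<in>Xi0 r1 r2. \<forall>n. dist_nearest_int (xseq \<alpha> r1 r2 g n) = \<bar>window_sum h s n\<bar> / \<bar>of_int a0\<bar>"
proof -
  have a0: "\<bar>of_int a0\<bar> \<ge> (2::real)" using abs_a0 by linarith
  define e where "e n = - window_sum h s n / of_int a0" for n
  define u where "u = monic_recurrence d (coeff P) s"
  define x where "x n = of_int (u n) + e n" for n
  have solved: "(\<Sum>j\<le>d. of_int (coeff P j) * window_sum h s (n + j)) = of_int a0 * of_int (s n)" for n
    unfolding window_sum_def
  proof (rule inverse_conv(1))
    show "\<bar>real_of_int (s m)\<bar> \<le> of_int B" for m using b[of m] by linarith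
  qed (simp add: coeff_eq_0 d_def)
  have e_sum: "(\<Sum>j\<le>d. of_int (coeff P j) * e (n + j)) = - of_int (s n)" for n
  proof -
    have "(\<Sum>j\<le>d. of_int (coeff P j) * e (n + j))
        = - ((\<Sum>j\<le>d. of_int (coeff P j) * window_sum h s (n + j)) / of_int a0)"
      by (simp add: e_def sum_divide_distrib sum_negf)
    then show ?thesis using a0 by (simp add: solved)
  qed
  have "(\<Sum>j\<le>d. coeff P j * u (n + j)) = s n" for n
    unfolding u_def by (rule monic_recurrence_solves) (use monic in \<open>simp add: d_def\<close>)
  then have "(\<Sum>j\<le>d. of_int (coeff P j) * real_of_int (u (n + j))) = of_int (s n)" for n
    by (simp flip: of_int_mult of_int_sum)
  then have "(\<Sum>j\<le>d. of_int (coeff P j) * x (n + j)) = 0" for n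
    by (simp add: x_def distrib_left sum.distrib e_sum)
  then have "complex_of_real (\<Sum>j\<le>d. of_int (coeff P j) * x (n + j)) = 0" for n by simp
  then have "(\<Sum>j\<le>d. coeff (complex_poly P) j * of_real (x (n + j))) = 0" for n
    by (simp add: coeff_map_poly)
  from recurrence_power_sum[OF factorisation roots_distinct root_nonzero d_pos this]
  obtain g where g: "\<And>n. of_real (x n) = (\<Sum>i=1..d. g i * \<alpha> i ^ n)" by blast
  obtain g' where g': "g' \<in> Xi0 r1 r2" "\<And>n. xseq \<alpha> r1 r2 g' n = Re (\<Sum>i=1..d. g i * \<alpha> i ^ n)"
    using symmetrise[of r1 \<alpha> r2 g] enum degree_split unfolding root_enumeration_def by auto
  have "dist_nearest_int (xseq \<alpha> r1 r2 g' n) = \<bar>window_sum h s n\<bar> / \<bar>of_int a0\<bar>" for n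
  proof -
    have "\<bar>e n\<bar> = \<bar>window_sum h s n\<bar> / \<bar>of_int a0\<bar>" by (simp add: e_def)
    moreover have "\<bar>e n\<bar> \<le> 1/2"
      unfolding calculation using a0 small[of n] by (simp add: field_simps)
    moreover have "xseq \<alpha> r1 r2 g' n = x n" unfolding g'(2) g[symmetric] by simp
    ultimately show ?thesis by (simp add: x_def dist_nearest_int_eq)
  qed
  with g'(1) show ?thesis by blast
qed

text \<open>
  The coefficients in \<open>E_sym_trunc\<close> are those of the partial fractions of \<open>hom\<close>, so the sum over the roots
  turns the series \<open>\<Sum> s\<^sub>m X\<^sub>i\<^sup>m\<close> into the window sum \<open>\<Sum> h\<^sub>m s\<^sub>m\<close>.
\<close>

lemma E_sym_trunc_eq: "E_sym_trunc d k X = of_real (threshold_approx h k)"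
proof -
  let ?A = "\<lambda>i. \<Prod>j\<in>{1..d} - {i}. X i / (X i - X j)"
  have E: "(\<lambda>m. \<Sum>i=1..d. ?A i * (of_int (tm_digit k m) * X i ^ m)) sums E_sym_trunc d k X"
    unfolding E_sym_trunc_def
    by (intro sums_sum sums_mult E_trunc_series X_nonzero cmod_X)
  have "(\<Sum>i=1..d. ?A i * (of_int (tm_digit k m) * X i ^ m)) = of_real (h m * of_int (tm_digit k m))" for m
  proof -
    have "(\<Sum>i=1..d. ?A i * (of_int (tm_digit k m) * X i ^ m)) = of_int (tm_digit k m) * hom m"
      unfolding hom_power_sum sum_distrib_left by (rule sum.cong) (simp_all add: mult_ac)
    then show ?thesis by (simp add: hom_real)
  qed
  with E have "(\<lambda>m. complex_of_real (h m * of_int (tm_digit k m))) sums E_sym_trunc d k X" by simp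
  moreover have "(\<lambda>m. h m * of_int (tm_digit k m)) sums window_sum h (tm_digit k) 0"
  proof -
    have "\<bar>real_of_int (tm_digit k m)\<bar> \<le> 1" for m using tm_digit_bound[of k m] by linarith
    from summable_sums[OF summable_weighted_bounded(1)[OF h_summable h_nonneg this]]
    show ?thesis by (simp add: window_sum_def)
  qed
  then have "(\<lambda>m. complex_of_real (h m * of_int (tm_digit k m))) sums of_real (window_sum h (tm_digit k) 0)"
    by (rule sums_of_real)
  ultimately have "E_sym_trunc d k X = of_real (window_sum h (tm_digit k) 0)" by (rule sums_unique2)
  then show ?thesis
    using window_sum_primitive[OF halving tm_approx_sign tm_digit_eq, of k 0] tm_approx_start(1)[of k]
    by (simp add: threshold_approx_def)
qed

lemma E_sym_eq: "E_sym d X = of_real (threshold h)"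
proof (rule LIMSEQ_unique)
  show "(\<lambda>k. E_sym_trunc d k X) \<longlonglongrightarrow> E_sym d X"
    unfolding E_sym_trunc_def E_sym_def
    by (intro tendsto_sum tendsto_mult tendsto_const E_trunc_tendsto X_nonzero cmod_X)
  show "(\<lambda>k. E_sym_trunc d k X) \<longlonglongrightarrow> of_real (threshold h)"
    unfolding E_sym_trunc_eq by (intro tendsto_of_real threshold_approx_props(3)[OF halving])
qed

abbreviation spectrum :: "real set" where
  "spectrum \<equiv> limsup_spectrum \<alpha> r1 r2"

lemma threshold_approx_in_spectrum: "threshold_approx h k / \<bar>of_int a0\<bar> \<in> spectrum"
proof -
  obtain g where g: "g \<in> Xi0 r1 r2"
    "\<And>n. dist_nearest_int (xseq \<alpha> r1 r2 g n) = \<bar>window_sum h (tm_digit k) n\<bar> / \<bar>of_int a0\<bar>"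
    using orbit_of_digits[OF tm_digit_bound abs_window_sum_primitive(2)[OF halving tm_approx_sign tm_digit_eq]]
    by blast
  have "limsup (\<lambda>n. ereal \<bar>window_sum h (tm_digit k) n\<bar>) = ereal (threshold_approx h k)"
    by (rule limsup_window_sum_periodic[OF halving tm_approx_sign tm_digit_eq, of _ 0])
       (simp add: tm_approx_start(1) del: tm_approx.simps)
  then have "limsup (\<lambda>n. ereal \<bar>window_sum h (tm_digit k) n\<bar> * ereal (1 / \<bar>of_int a0\<bar>))
      = ereal (threshold_approx h k / \<bar>of_int a0\<bar>)"
    by (subst limsup_ereal_mult_right) auto
  then show ?thesis
    unfolding limsup_spectrum_def by (intro CollectI bexI[OF _ g(1)]) (simp add: g(2))
qed

text \<open>
  Digits that vanish eventually give the value \<open>0\<close>; all others fall under the analysis of window sums.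
\<close>

lemma spectrum_below_threshold:
  assumes "l \<in> spectrum" "l < threshold h / \<bar>of_int a0\<bar>"
  shows "l = 0 \<or> (\<exists>k. l = threshold_approx h k / \<bar>of_int a0\<bar>)"
proof -
  have a0: "\<bar>of_int a0\<bar> > (0::real)" using abs_a0 by linarith
  obtain g where g: "limsup (\<lambda>n. ereal (dist_nearest_int (xseq \<alpha> r1 r2 g n))) = ereal l"
    using assms(1) unfolding limsup_spectrum_def by blast
  obtain s B where s: "\<And>m. \<bar>s m\<bar> \<le> B"
    "\<And>n. \<bar>window_sum h s n\<bar> = \<bar>of_int a0\<bar> * dist_nearest_int (xseq \<alpha> r1 r2 g n)"
    using digits_of_orbit[of g] by blast
  have "limsup (\<lambda>n. ereal (dist_nearest_int (xseq \<alpha> r1 r2 g n)) * ereal \<bar>of_int a0\<bar>) = ereal l * ereal \<bar>of_int a0\<bar>"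
    by (subst limsup_ereal_mult_right) (use a0 g in auto)
  then have lim: "limsup (\<lambda>n. ereal \<bar>window_sum h s n\<bar>) = ereal (\<bar>of_int a0\<bar> * l)"
    unfolding s(2) by (simp add: mult.commute)
  show ?thesis
  proof (cases "\<forall>n. \<exists>m\<ge>n. s m \<noteq> 0")
    case True
    have "\<bar>of_int a0\<bar> * l < threshold h" using assms(2) a0 by (simp add: field_simps)
    then have "\<exists>k. limsup (\<lambda>n. ereal \<bar>window_sum h s n\<bar>) = ereal (threshold_approx h k)"
      using low_limsup_window_sum[where s=s, OF halving s(1)] True lim by auto
    then obtain k where "\<bar>of_int a0\<bar> * l = threshold_approx h k" using lim by auto
    then have "l = threshold_approx h k / \<bar>of_int a0\<bar>" using a0 by (simp add: field_simps)
    then show ?thesis by blast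
  next
    case False
    then obtain N where N: "\<And>m. m \<ge> N \<Longrightarrow> s m = 0" by blast
    then have z: "window_sum h s n = 0" if "n \<ge> N" for n
      using that by (simp add: window_sum_def)
    have "limsup (\<lambda>n. ereal \<bar>window_sum h s n\<bar>) = ereal 0"
    proof (rule limsup_eq_attained)
      have ev: "\<forall>\<^sub>F n in sequentially. \<bar>window_sum h s n\<bar> = 0"
        using z by (auto simp: eventually_sequentially)
      then show "\<exists>\<^sub>F n in sequentially. \<bar>window_sum h s n\<bar> = 0"
        by (rule eventually_frequently[OF sequentially_bot])
      show "\<forall>\<^sub>F n in sequentially. \<bar>window_sum h s n\<bar> \<le> 0"
        by (rule eventually_mono[OF ev]) simp
    qed
    then show ?thesis using lim a0 by simp
  qed
qed

text \<open>
  The approximants accumulate only at the threshold, so below any smaller \<open>c\<close> the spectrum is finite.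
\<close>

lemma minimal_limit_point_threshold: "minimal_limit_point (threshold h / \<bar>of_int a0\<bar>) spectrum"
  unfolding minimal_limit_point_def
proof (intro conjI allI impI)
  have a0: "\<bar>of_int a0\<bar> > (0::real)" using abs_a0 by linarith
  have lim: "(\<lambda>k. threshold_approx h k / \<bar>of_int a0\<bar>) \<longlonglongrightarrow> threshold h / \<bar>of_int a0\<bar>"
    by (intro tendsto_divide tendsto_const threshold_approx_props(3)[OF halving]) (use a0 in simp)
  show "threshold h / \<bar>of_int a0\<bar> islimpt spectrum"
    unfolding islimpt_sequential
  proof (intro exI conjI allI)
    show "threshold_approx h k / \<bar>of_int a0\<bar> \<in> spectrum - {threshold h / \<bar>of_int a0\<bar>}" for k
      using threshold_approx_in_spectrum[of k] threshold_approx_props(2)[OF halving, of k] a0 by auto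
  qed (rule lim)
  fix y assume y: "y islimpt spectrum"
  show "threshold h / \<bar>of_int a0\<bar> \<le> y"
  proof (rule ccontr)
    assume "\<not> threshold h / \<bar>of_int a0\<bar> \<le> y"
    then obtain c where c: "y < c" "c < threshold h / \<bar>of_int a0\<bar>" using dense not_le by metis
    have "\<forall>\<^sub>F k in sequentially. c < threshold_approx h k / \<bar>of_int a0\<bar>"
      using lim c(2) by (rule order_tendstoD(1))
    then obtain K where K: "\<And>k. k \<ge> K \<Longrightarrow> c < threshold_approx h k / \<bar>of_int a0\<bar>"
      by (auto simp: eventually_sequentially)
    have "spectrum \<inter> {..<c} \<subseteq> insert 0 ((\<lambda>k. threshold_approx h k / \<bar>of_int a0\<bar>) ` {..<K})"
    proof
      fix l assume l: "l \<in> spectrum \<inter> {..<c}"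
      then show "l \<in> insert 0 ((\<lambda>k. threshold_approx h k / \<bar>of_int a0\<bar>) ` {..<K})"
        using spectrum_below_threshold[of l] c(2) K by (force simp: not_less[symmetric])
    qed
    then have "finite (spectrum \<inter> {..<c})" by (rule finite_subset) simp
    moreover have "y islimpt (spectrum \<inter> {..<c})"
      unfolding islimpt_def
    proof (intro allI impI)
      fix U assume "y \<in> U" "open U"
      then have "y \<in> U \<inter> {..<c}" "open (U \<inter> {..<c})" using c(1) by auto
      from y[unfolded islimpt_def, rule_format, OF this]
      obtain z where "z \<in> spectrum" "z \<in> U \<inter> {..<c}" "z \<noteq> y" by auto
      then show "\<exists>z\<in>spectrum \<inter> {..<c}. z \<in> U \<and> z \<noteq> y" by blast
    qed
    ultimately show False by (simp add: islimpt_finite)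
  qed
qed

lemma spectrum_Int_threshold:
  "spectrum \<inter> {0<..<threshold h / \<bar>of_int a0\<bar>} = range (\<lambda>k. threshold_approx h k / \<bar>of_int a0\<bar>)"
proof -
  have a0: "\<bar>of_int a0\<bar> > (0::real)" using abs_a0 by linarith
  show ?thesis
  proof (intro equalityI subsetI)
    fix l assume "l \<in> spectrum \<inter> {0<..<threshold h / \<bar>of_int a0\<bar>}"
    then show "l \<in> range (\<lambda>k. threshold_approx h k / \<bar>of_int a0\<bar>)"
      using spectrum_below_threshold[of l] by auto
  next
    fix l assume "l \<in> range (\<lambda>k. threshold_approx h k / \<bar>of_int a0\<bar>)"
    then obtain k where "l = threshold_approx h k / \<bar>of_int a0\<bar>" by blast
    then show "l \<in> spectrum \<inter> {0<..<threshold h / \<bar>of_int a0\<bar>}"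
      using threshold_approx_in_spectrum[of k] threshold_approx_props(1,2)[OF halving, of k] a0
      by (simp add: divide_strict_right_mono)
  qed
qed

end

theorem theorem5:
  fixes P :: "int poly" and \<alpha> :: "nat \<Rightarrow> complex" and r1 r2 :: nat and r :: real
  assumes "admissible P"
    and "root_enumeration P \<alpha> r1 r2"
    and "lead_coeff P = 1"
    and "expansive P r1 r2"
    and "1 < r" and "\<forall>i\<in>{1..r1 + 2 * r2}. r < cmod (\<alpha> i)"
  shows
    "(monotone_chain (\<lambda>m. rho P r (- int m)) \<longleftrightarrow>
      monotone_chain (\<lambda>m. complete_hom (degree P) m (\<lambda>i. inverse (\<alpha> i)))) \<and>
     (monotone_chain (\<lambda>m. rho P r (- int m)) \<longrightarrow>
       (let a0 = complex_of_int \<bar>coeff P 0\<bar>;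
            v = inverse a0 * E_sym (degree P) (\<lambda>i. inverse (\<alpha> i));
            w = (\<lambda>k. 1 / a0 * E_sym_trunc (degree P) k (\<lambda>i. inverse (\<alpha> i)))
        in v \<in> \<real> \<and> (\<forall>k. w k \<in> \<real>) \<and>
           minimal_limit_point (Re v) (limsup_spectrum \<alpha> r1 r2) \<and>
           limsup_spectrum \<alpha> r1 r2 \<inter> {0<..<Re v} = range (\<lambda>k. Re (w k))))"
proof -
  interpret monic_expansive P \<alpha> r1 r2 using assms(1-4) by unfold_locales
  have hom: "(\<lambda>m. complete_hom (degree P) m (\<lambda>i. inverse (\<alpha> i))) = hom"
    by (simp add: hom_def[abs_def] X_def[abs_def] d_def)
  have equiv: "monotone_chain (\<lambda>m. rho P r (- int m)) \<longleftrightarrow> monotone_chain hom"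
    by (rule chain_equivalence[OF assms(5)]) (use assms(6) degree_split in simp)
  show ?thesis unfolding hom
  proof (intro conjI impI equiv)
    assume "monotone_chain (\<lambda>m. rho P r (- int m))"
    then interpret monic_expansive_chain P \<alpha> r1 r2
      by unfold_locales (simp add: equiv)
    have c: "complex_of_int \<bar>coeff P 0\<bar> = of_real \<bar>of_int a0\<bar>"
      by (simp add: a0_def flip: of_int_abs)
    have v: "inverse (complex_of_int \<bar>coeff P 0\<bar>) * E_sym (degree P) (\<lambda>i. inverse (\<alpha> i))
        = of_real (threshold h / \<bar>of_int a0\<bar>)"
      unfolding c using E_sym_eq by (simp add: X_def[abs_def] d_def divide_inverse mult.commute)
    have w: "1 / complex_of_int \<bar>coeff P 0\<bar> * E_sym_trunc (degree P) k (\<lambda>i. inverse (\<alpha> i))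
        = of_real (threshold_approx h k / \<bar>of_int a0\<bar>)" for k
      unfolding c using E_sym_trunc_eq[of k] by (simp add: X_def[abs_def] d_def divide_inverse mult.commute)
    show "let a0 = complex_of_int \<bar>coeff P 0\<bar>;
            v = inverse a0 * E_sym (degree P) (\<lambda>i. inverse (\<alpha> i));
            w = (\<lambda>k. 1 / a0 * E_sym_trunc (degree P) k (\<lambda>i. inverse (\<alpha> i)))
        in v \<in> \<real> \<and> (\<forall>k. w k \<in> \<real>) \<and>
           minimal_limit_point (Re v) (limsup_spectrum \<alpha> r1 r2) \<and>
           limsup_spectrum \<alpha> r1 r2 \<inter> {0<..<Re v} = range (\<lambda>k. Re (w k))"
      unfolding Let_def v w Re_complex_of_real
      using minimal_limit_point_threshold spectrum_Int_threshold by simp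
  qed
qed

end
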